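(* Let $\Omega=\{x\in\mathbb{R}^2: |x|<1\}$ be the unit disk and let $q\in F$, i.e. $q(x)=\gamma\chi_{(0,b)}(|x|)$ with $b\in(0,1)$ and $\gamma\in[0,1]$. Then the Dirichlet-to-Neumann map $\Lambda_q$ satisfies $$\Lambda_q\left(e^{in\theta}\right)=c_n e^{in\theta},\qquad n\in\mathbb{Z},$$ where $$c_0=\frac{-b\sqrt{\gamma}\,J_1(\sqrt{\gamma}b)}{b\log b\,\sqrt{\gamma}\,J_1(\sqrt{\gamma}b)+J_0(\sqrt{\gamma}b)},$$ $$c_n=c_{-n}=n\,\frac{J_{n-1}(\sqrt{\gamma}b)-b^{2n}J_{n+1}(\sqrt{\gamma}b)}{J_{n-1}(\sqrt{\gamma}b)+b^{2n}J_{n+1}(\sqrt{\gamma}b)},\qquad n\ge 1,$$ and $J_n$ are the Bessel functions of the first kind. When $\gamma=0$ (i.e. $q=0$), these expressions are understood as $c_n=c_{-n}=n$ for $n=0,1,2,\dots$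
   Context: Functions on $\partial\Omega$ are identified with $2\pi$-periodic functions $g(\theta)$ of the polar angle; $g=\sum_{n\in\mathbb{Z}}g_ne^{in\theta}$ with $g_n=\frac1{2\pi}\int_0^{2\pi}g(t)e^{-int}\,dt$. The space $H^\alpha_{\#}$ ($\alpha=\pm 1/2$) consists of the $g$ with $\|g\|_\alpha^2=\sum_{n\in\mathbb{Z}}(1+n^2)^\alpha|g_n|^2<\infty$. $\chi_{(0,b)}$ is the characteristic function of the interval $(0,b)$, and $F=\{q\in L^\infty(\Omega): q(x)=\gamma\chi_{(0,b)}(|x|),\ b\in(0,1),\ \gamma\in[0,1]\}$. For $q\in F$, the Dirichlet-to-Neumann map $\Lambda_q:H^{1/2}_{\#}\to H^{-1/2}_{\#}$ is $\Lambda_q g=\frac{\partial v}{\partial r}(1,\cdot)$, where $v(r,\theta)=u(r\cos\theta,r\sin\theta)$ and $u$ is the unique solution of $\Delta u+q(x)u=0$ in $\Omega$ with $u=g$ on $\partial\Omega$ (equivalently, in polar coordinates, $r^2v_{rr}+rv_r+v_{\theta\theta}+r^2q(r)v=0$ on $(0,1)\times[0,2\pi)$, $v$ bounded as $r\to0^+$, $v(1,\theta)=g(\theta)$). *)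

theory Defs
  imports "HOL-Analysis.Analysis"
begin

text \<open>Bessel functions of the first kind, of nonnegative integer order.\<close>

definition bessel_J :: "nat \<Rightarrow> real \<Rightarrow> real" where
  "bessel_J n x = (\<Sum>m. (-1) ^ m / (fact m * fact (m + n)) * (x / 2) ^ (2 * m + n))"

definition fourier_coeffs :: "(real \<Rightarrow> complex) \<Rightarrow> int \<Rightarrow> complex" where
  "fourier_coeffs g n =
     of_real (1 / (2 * pi)) * (LINT t:{0..2*pi}|lborel. g t * exp (- \<i> * of_int n * of_real t))"

text \<open>
  Elements of the periodic Sobolev space of order \<open>\<alpha>\<close> are represented by their Fourier
  coefficients; for \<open>\<alpha> < 0\<close> they need not be functions.  A function \<open>g\<close> is identified with
  the element \<open>fourier_coeffs g\<close>.
\<close>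

definition sobolev :: "real \<Rightarrow> (int \<Rightarrow> complex) set" where
  "sobolev \<alpha> = {a. (\<lambda>n. (1 + (of_int n)\<^sup>2) powr \<alpha> * (norm (a n))\<^sup>2) summable_on UNIV}"

definition sobolev_norm :: "real \<Rightarrow> (int \<Rightarrow> complex) \<Rightarrow> real" where
  "sobolev_norm \<alpha> a = sqrt (\<Sum>\<^sub>\<infinity>n. (1 + (of_int n)\<^sup>2) powr \<alpha> * (norm (a n))\<^sup>2)"

text \<open>
  Convergence in the Sobolev norm.  Membership of the difference is required explicitly because
  \<open>infsum\<close> is 0 on non-summable families.
\<close>

definition sobolev_tendsto ::
    "real \<Rightarrow> ('a \<Rightarrow> int \<Rightarrow> complex) \<Rightarrow> (int \<Rightarrow> complex) \<Rightarrow> 'a filter \<Rightarrow> bool" where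
  "sobolev_tendsto \<alpha> G a F \<longleftrightarrow>
     (\<forall>\<^sub>F r in F. (\<lambda>n. G r n - a n) \<in> sobolev \<alpha>) \<and>
     ((\<lambda>r. sobolev_norm \<alpha> (\<lambda>n. G r n - a n)) \<longlongrightarrow> 0) F"

definition L2_on :: "'a::euclidean_space set \<Rightarrow> ('a \<Rightarrow> 'b::euclidean_space) \<Rightarrow> bool" where
  "L2_on S f \<longleftrightarrow> set_borel_measurable lborel S f \<and> set_integrable lborel S (\<lambda>x. (norm (f x))\<^sup>2)"

definition H_half :: "(real \<Rightarrow> complex) set" where
  "H_half = {g. (\<forall>\<theta>. g (\<theta> + 2 * pi) = g \<theta>) \<and> L2_on {0..2*pi} g \<and> fourier_coeffs g \<in> sobolev (1/2)}"

abbreviation disc :: "(real \<times> real) set" where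
  "disc \<equiv> ball 0 1"

text \<open>\<open>f\<close> is of class \<open>C\<^sup>1\<close> on \<open>S\<close> with gradient \<open>Df\<close>.\<close>

definition C1_on :: "(real \<times> real) set \<Rightarrow> (real \<times> real \<Rightarrow> complex) \<Rightarrow>
    (real \<times> real \<Rightarrow> complex \<times> complex) \<Rightarrow> bool" where
  "C1_on S f Df \<longleftrightarrow>
     (\<forall>x\<in>S. (f has_derivative (\<lambda>h. fst h *\<^sub>R fst (Df x) + snd h *\<^sub>R snd (Df x))) (at x within S)) \<and>
     continuous_on S Df"

text \<open>
  \<open>u\<close> belongs to \<open>H\<^sup>1\<close> of the disc, its weak gradient is \<open>Du\<close> and its boundary trace is \<open>g\<close>:
  the pair \<open>(u, g)\<close> is a limit of \<open>C\<^sup>1\<close> functions on the closed disc and their restrictions to the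
  circle, in \<open>H\<^sup>1\<close> and in \<open>L\<^sup>2\<close> of the circle.  Since \<open>C\<^sup>1\<close> functions on the closed disc are
  dense in \<open>H\<^sup>1\<close>, every element of \<open>H\<^sup>1\<close> arises in this way.
\<close>

definition H1_trace :: "(real \<times> real \<Rightarrow> complex) \<Rightarrow> (real \<times> real \<Rightarrow> complex \<times> complex) \<Rightarrow>
    (real \<Rightarrow> complex) \<Rightarrow> bool" where
  "H1_trace u Du g \<longleftrightarrow> L2_on disc u \<and> L2_on disc Du \<and> L2_on {0..2*pi} g \<and>
     (\<exists>\<phi> D\<phi>. (\<forall>k::nat. C1_on (cball 0 1) (\<phi> k) (D\<phi> k)) \<and>
        (\<lambda>k. LINT x:disc|lborel. (norm (\<phi> k x - u x))\<^sup>2) \<longlonglongrightarrow> 0 \<and>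
        (\<lambda>k. LINT x:disc|lborel. (norm (D\<phi> k x - Du x))\<^sup>2) \<longlonglongrightarrow> 0 \<and>
        (\<lambda>k. LINT \<theta>:{0..2*pi}|lborel. (norm (\<phi> k (cos \<theta>, sin \<theta>) - g \<theta>))\<^sup>2) \<longlonglongrightarrow> 0)"

text \<open>
  Weak solutions of \<open>\<Delta>u + q u = 0\<close> in the disc with \<open>u = g\<close> on the circle; the test functions
  are the \<open>H\<^sup>1\<close> functions of trace zero.
\<close>

definition weak_solution :: "(real \<times> real \<Rightarrow> real) \<Rightarrow> (real \<Rightarrow> complex) \<Rightarrow>
    (real \<times> real \<Rightarrow> complex) \<Rightarrow> bool" where
  "weak_solution q g u \<longleftrightarrow>
     (\<exists>Du. H1_trace u Du g \<and>
       (\<forall>w Dw. H1_trace w Dw (\<lambda>_. 0) \<longrightarrow>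
          (LINT x:disc|lborel. fst (Du x) * cnj (fst (Dw x)) + snd (Du x) * cnj (snd (Dw x))
             - of_real (q x) * u x * cnj (w x)) = 0))"

text \<open>
  \<open>h = \<partial>v/\<partial>r(1,\<cdot>)\<close>, where \<open>v(r,\<theta>) = u(r cos \<theta>, r sin \<theta>)\<close>, as an element of the Sobolev space of
  order \<open>-1/2\<close>: the limit of \<open>\<partial>v/\<partial>r(r,\<cdot>)\<close> in that space as \<open>r\<close> increases to 1.  As \<open>u\<close> is only
  determined almost everywhere, \<open>v\<close> is formed from a representative \<open>w\<close> that is \<open>C\<^sup>1\<close> near the
  circle.  Such a representative exists for solutions whose potential vanishes near the circle,
  since these are harmonic there.
\<close>

definition normal_derivative :: "(real \<times> real \<Rightarrow> complex) \<Rightarrow> (int \<Rightarrow> complex) \<Rightarrow> bool" where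
  "normal_derivative u h \<longleftrightarrow> h \<in> sobolev (-1/2) \<and>
     (\<exists>\<rho>\<in>{0<..<1}. \<exists>w Dw.
        (AE x in lborel. \<rho> < norm x \<and> norm x < 1 \<longrightarrow> w x = u x) \<and>
        C1_on {x. \<rho> < norm x \<and> norm x < 1} w Dw \<and>
        sobolev_tendsto (-1/2)
          (\<lambda>r. fourier_coeffs (\<lambda>\<theta>. vector_derivative (\<lambda>s. w (s * cos \<theta>, s * sin \<theta>)) (at r)))
          h (at_left 1))"

text \<open>
  The Dirichlet-to-Neumann map on \<open>H_half\<close>, with values in \<open>sobolev (-1/2)\<close>, for potentials
  vanishing near the circle.
\<close>

definition dtn_map :: "(real \<times> real \<Rightarrow> real) \<Rightarrow> (real \<Rightarrow> complex) \<Rightarrow> int \<Rightarrow> complex" where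
  "dtn_map q g = (THE h. g \<in> H_half \<and> (\<exists>u. weak_solution q g u \<and> normal_derivative u h))"

definition dtn_coeff :: "real \<Rightarrow> real \<Rightarrow> int \<Rightarrow> real" where
  "dtn_coeff b \<gamma> n =
    (let s = sqrt \<gamma> * b; m = nat \<bar>n\<bar> in
     if \<gamma> = 0 then real m
     else if n = 0 then
       (- b * sqrt \<gamma> * bessel_J 1 s) / (b * ln b * sqrt \<gamma> * bessel_J 1 s + bessel_J 0 s)
     else
       real m * ((bessel_J (m - 1) s - b ^ (2 * m) * bessel_J (m + 1) s) /
                 (bessel_J (m - 1) s + b ^ (2 * m) * bessel_J (m + 1) s)))"

end

theory Submission
  imports Defs
begin

text \<open>
  Let \<open>m = |n|\<close>. The radial equation with bounded solutions is solved inside \<open>|x| < b\<close> by a multiple of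
  \<open>J\<^sub>m(\<surd>\<gamma> r)\<close> and outside by a combination of \<open>r\<^bsup>m\<^esup>\<close> and \<open>r\<^bsup>-m\<^esup>\<close> (or \<open>ln r\<close> if \<open>m = 0\<close>); matching value and
  derivative at \<open>r = b\<close> gives a function \<open>u\<close> that is \<open>C\<^sup>1\<close> on the closed disc, equal to \<open>e\<^bsup>in\<theta>\<^esup>\<close> on the circle,
  with radial derivative \<open>c\<^sub>n e\<^bsup>in\<theta>\<^esup>\<close> there. It is a weak solution by Green's identity, which, like the
  Poincare inequality below, is an instance of the divergence theorem on the disc.

  The weak solution is unique because a function of trace zero satisfies
  \<open>\<integral>|d|\<^sup>2 \<le> \<integral>|x|\<^sup>2|\<nabla>d|\<^sup>2\<close>, while \<open>q \<le> 1\<close>. Any \<open>C\<^sup>1\<close> representative near the circle then coincides with \<open>u\<close>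
  on an annulus, so that its normal derivative is determined as well.
\<close>

subsection \<open>Square integrable functions\<close>

text \<open>The bound \<open>\<gamma> \<le> 1\<close> enters twice. It makes an inequality with
  constant 1 and weight |x|^2 enough for uniqueness, the gap being supplied by |x| < 1. Together
  with b < 1 it also keeps the Bessel argument \<open>\<tau>\<close> at most 1/4, where the leading
  terms of an alternating series show that value and derivative can be matched at r = b. No
  knowledge of Bessel zeros or of Dirichlet eigenvalues enters. Regularity shapes the rest. For
  \<gamma> > 0 the second derivatives of \<open>u\<close> jump at r = b together with the potential,
  and test functions are only H1 limits. So the divergence theorem tolerates an exceptional set that
  meets each axis-parallel line in finitely many points, and integral relations are proved for C1
  functions and then carried to the limit in L2. Polar coordinates are singular at the origin. The
  solution is therefore written as z^m or conj(z)^m times a function of |z|^2 and differentiated in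
  Cartesian coordinates; polar form returns only for the boundary derivative.\<close>

lemma L2_onD:
  assumes "L2_on S f"
  shows L2_on_measurable: "set_borel_measurable lborel S f"
    and L2_on_norm_sq: "set_integrable lborel S (\<lambda>x. (norm (f x))\<^sup>2)"
  using assms unfolding L2_on_def by blast+

text \<open>\<open>set_borel_measurable\<close> only speaks of functions cut off by the indicator of
  \<open>S\<close>. Cutting off both factors is the same as cutting off the bilinear expression
  once.\<close>

lemma L2_on_bilinear_measurable:
  fixes b :: "'b::euclidean_space \<Rightarrow> 'c::euclidean_space \<Rightarrow> 'd::euclidean_space"
  assumes b: "bounded_bilinear b"
    and f: "set_borel_measurable lborel S f" and g: "set_borel_measurable lborel S g"
  shows "set_borel_measurable lborel S (\<lambda>x. b (f x) (g x))"
proof -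
  interpret bounded_bilinear b by fact
  have "(\<lambda>x. b (indicator S x *\<^sub>R f x) (indicator S x *\<^sub>R g x)) \<in> borel_measurable lborel"
  proof (rule borel_measurable_continuous_Pair[where H = b])
    show "continuous_on UNIV (\<lambda>x. b (fst x) (snd x))"
      by (intro continuous_on continuous_intros)
  qed (use f g in \<open>simp_all add: set_borel_measurable_def\<close>)
  moreover have "(\<lambda>x. b (indicator S x *\<^sub>R f x) (indicator S x *\<^sub>R g x)) =
      (\<lambda>x. indicator S x *\<^sub>R b (f x) (g x))"
    by (auto simp: indicator_def zero_left)
  ultimately show ?thesis by (simp add: set_borel_measurable_def)
qed

text \<open>Instead of Cauchy-Schwarz, pq \<le> p^2 + q^2 gives an integrable majorant. A general
  bounded bilinear map covers real inner products, scaling, \<open>a * cnj b\<close> and the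
  Hermitian product of gradients at once.\<close>

lemma L2_on_bilinear_integrable:
  fixes b :: "'b::euclidean_space \<Rightarrow> 'c::euclidean_space \<Rightarrow> 'd::euclidean_space"
  assumes b: "bounded_bilinear b" and f: "L2_on S f" and g: "L2_on S g"
  shows "set_integrable lborel S (\<lambda>x. b (f x) (g x))"
proof -
  interpret bounded_bilinear b by fact
  obtain K where K: "K > 0" "\<And>x y. norm (b x y) \<le> norm x * norm y * K"
    using pos_bounded by blast
  have "set_integrable lborel S (\<lambda>x. K * ((norm (f x))\<^sup>2 + (norm (g x))\<^sup>2))"
    by (intro set_integrable_mult_right set_integral_add(1) L2_on_norm_sq f g)
  then show ?thesis
  proof (rule set_integrable_bound)
    show "set_borel_measurable lborel S (\<lambda>x. b (f x) (g x))"
      by (rule L2_on_bilinear_measurable[OF b L2_on_measurable[OF f] L2_on_measurable[OF g]])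
    have "norm (b (f x) (g x)) \<le> norm (K * ((norm (f x))\<^sup>2 + (norm (g x))\<^sup>2))" for x
    proof -
      have "2 * (norm (f x) * norm (g x)) \<le> (norm (f x))\<^sup>2 + (norm (g x))\<^sup>2"
        using sum_squares_bound[of "norm (f x)" "norm (g x)"] by simp
      moreover have "0 \<le> norm (f x) * norm (g x)" by simp
      ultimately have "norm (f x) * norm (g x) \<le> (norm (f x))\<^sup>2 + (norm (g x))\<^sup>2"
        by linarith
      then have "norm (f x) * norm (g x) * K \<le> ((norm (f x))\<^sup>2 + (norm (g x))\<^sup>2) * K"
        using K(1) by (intro mult_right_mono) auto
      with K(2)[of "f x" "g x"] have "norm (b (f x) (g x)) \<le> K * ((norm (f x))\<^sup>2 + (norm (g x))\<^sup>2)"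
        unfolding mult.commute[of K] by (rule order_trans)
      then show ?thesis unfolding real_norm_def by linarith
    qed
    then show "AE x in lborel. x \<in> S \<longrightarrow>
        norm (b (f x) (g x)) \<le> norm (K * ((norm (f x))\<^sup>2 + (norm (g x))\<^sup>2))"
      by simp
  qed
qed

lemma L2_on_diff:
  fixes f g :: "'a::euclidean_space \<Rightarrow> 'b::euclidean_space"
  assumes f: "L2_on S f" and g: "L2_on S g"
  shows "L2_on S (\<lambda>x. f x - g x)"
proof -
  have m: "set_borel_measurable lborel S (\<lambda>x. f x - g x)"
    using f g unfolding L2_on_def set_borel_measurable_def scaleR_diff_right
    by (intro borel_measurable_diff) blast+
  have "set_integrable lborel S (\<lambda>x. (norm (f x))\<^sup>2 - 2 * (f x \<bullet> g x) + (norm (g x))\<^sup>2)"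
    by (intro set_integral_add(1) set_integral_diff(1) set_integrable_mult_right L2_on_norm_sq f g
        L2_on_bilinear_integrable[OF bounded_bilinear_inner f g])
  moreover have "(norm (f x - g x))\<^sup>2 = (norm (f x))\<^sup>2 - 2 * (f x \<bullet> g x) + (norm (g x))\<^sup>2" for x
    by (simp add: power2_norm_eq_inner algebra_simps inner_commute)
  ultimately show ?thesis using m by (simp add: L2_on_def)
qed

lemma continuous_on_imp_L2_on:
  fixes f :: "'a::euclidean_space \<Rightarrow> 'b::euclidean_space"
  assumes "compact S" "continuous_on S f" "T \<in> sets lborel" "T \<subseteq> S"
  shows "L2_on T f"
proof -
  have "set_integrable lborel S f" "set_integrable lborel S (\<lambda>x. (norm (f x))\<^sup>2)"
    unfolding set_integrable_def using assms(1,2)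
    by (auto intro!: borel_integrable_compact[of S "\<lambda>x. (norm (f x))\<^sup>2", simplified]
        borel_integrable_compact continuous_intros)
  then have "set_integrable lborel T f" "set_integrable lborel T (\<lambda>x. (norm (f x))\<^sup>2)"
    using assms(3,4) by (blast intro: set_integrable_subset)+
  then show ?thesis
    unfolding L2_on_def set_borel_measurable_def set_integrable_def
    by (blast intro: borel_measurable_integrable)
qed

text \<open>Serves the weights that occur later: the potential, |z|, sqrt(1 - |z|^2) and the
  discontinuous second derivative of the radial profile.\<close>

lemma L2_on_bounded_mult:
  fixes f :: "'a::euclidean_space \<Rightarrow> 'b::euclidean_space" and w :: "'a \<Rightarrow> real"
  assumes f: "L2_on S f" and w: "w \<in> borel_measurable lborel" "\<And>x. x \<in> S \<Longrightarrow> \<bar>w x\<bar> \<le> M"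
  shows "L2_on S (\<lambda>x. w x *\<^sub>R f x)"
proof -
  have "(\<lambda>x. w x *\<^sub>R (indicator S x *\<^sub>R f x)) \<in> borel_measurable lborel"
    using f w(1) unfolding L2_on_def set_borel_measurable_def
    by (intro borel_measurable_scaleR[where f = w]) blast+
  then have m: "set_borel_measurable lborel S (\<lambda>x. w x *\<^sub>R f x)"
    unfolding set_borel_measurable_def scaleR_left_commute[of "indicator _ _"] .
  have "set_integrable lborel S (\<lambda>x. M\<^sup>2 * (norm (f x))\<^sup>2)"
    by (intro set_integrable_mult_right L2_on_norm_sq f)
  then have "set_integrable lborel S (\<lambda>x. (norm (w x *\<^sub>R f x))\<^sup>2)"
  proof (rule set_integrable_bound)
    have "(\<lambda>x. (norm (indicator S x *\<^sub>R (w x *\<^sub>R f x)))\<^sup>2) \<in> borel_measurable lborel"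
      using m unfolding set_borel_measurable_def
      by (intro borel_measurable_power borel_measurable_norm[THEN measurable_compose_rev])
    moreover have "(\<lambda>x. (norm (indicator S x *\<^sub>R (w x *\<^sub>R f x)))\<^sup>2) =
        (\<lambda>x. indicator S x *\<^sub>R (norm (w x *\<^sub>R f x))\<^sup>2)"
      by (auto simp: indicator_def)
    ultimately show "set_borel_measurable lborel S (\<lambda>x. (norm (w x *\<^sub>R f x))\<^sup>2)"
      by (simp add: set_borel_measurable_def)
    show "AE x in lborel. x \<in> S \<longrightarrow>
        norm ((norm (w x *\<^sub>R f x))\<^sup>2) \<le> norm (M\<^sup>2 * (norm (f x))\<^sup>2)"
    proof (intro AE_I2 impI)
      fix x assume "x \<in> S"
      then have "\<bar>w x\<bar>\<^sup>2 \<le> M\<^sup>2" using w(2) by (intro power_mono) auto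
      then show "norm ((norm (w x *\<^sub>R f x))\<^sup>2) \<le> norm (M\<^sup>2 * (norm (f x))\<^sup>2)"
        by (simp add: power_mult_distrib mult_right_mono)
    qed
  qed
  with m show ?thesis by (simp add: L2_on_def)
qed

lemma set_integral_nonneg':
  fixes f :: "'a \<Rightarrow> real"
  assumes "\<And>x. x \<in> S \<Longrightarrow> 0 \<le> f x"
  shows "0 \<le> (LINT x:S|M. f x)"
  unfolding set_lebesgue_integral_def using assms
  by (intro Bochner_Integration.integral_nonneg) (simp add: indicator_def)

text \<open>Young's inequality with a parameter, pq \<le> p^2/c + c q^2, takes the place of
  Cauchy-Schwarz. Choosing c of the size of the L2 distance makes both terms tend to 0.\<close>

lemma L2_on_bilinear_limit:
  fixes b :: "'b::euclidean_space \<Rightarrow> 'c::euclidean_space \<Rightarrow> 'd::euclidean_space"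
    and f :: "'a::euclidean_space \<Rightarrow> 'b"
  assumes b: "bounded_bilinear b" and F: "\<And>k::nat. L2_on S (F k)" and f: "L2_on S f"
    and g: "L2_on S g"
    and lim: "(\<lambda>k. LINT x:S|lborel. (norm (F k x - f x))\<^sup>2) \<longlonglongrightarrow> 0"
  shows "(\<lambda>k. LINT x:S|lborel. b (F k x) (g x)) \<longlonglongrightarrow> (LINT x:S|lborel. b (f x) (g x))"
proof -
  interpret bounded_bilinear b by fact
  obtain K where K: "K > 0" "\<And>x y. norm (b x y) \<le> norm x * norm y * K"
    using pos_bounded by blast
  define e where "e = (\<lambda>k. LINT x:S|lborel. (norm (F k x - f x))\<^sup>2)"
  define G where "G = (LINT x:S|lborel. (norm (g x))\<^sup>2)"
  \<comment> \<open>The ideal parameter is \<open>sqrt (e k)\<close>, but this may be 0; the added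
    null sequence makes division by \<open>c k\<close> legitimate.\<close>
  define c where "c = (\<lambda>k. sqrt (e k) + inverse (real (Suc k)))"
  have e0: "0 \<le> e k" for k unfolding e_def by (rule set_integral_nonneg') auto
  have c0: "0 < c k" for k unfolding c_def using e0[of k]
    by (intro add_nonneg_pos) auto
  have "norm ((LINT x:S|lborel. b (F k x) (g x)) - (LINT x:S|lborel. b (f x) (g x)))
      \<le> K * (sqrt (e k) + c k * G)" for k
  proof -
    have d: "L2_on S (\<lambda>x. F k x - f x)" by (intro L2_on_diff F f)
    have i: "set_integrable lborel S (\<lambda>x. b (F k x - f x) (g x))"
      by (intro L2_on_bilinear_integrable[OF b d g])
    have r: "set_integrable lborel S
        (\<lambda>x. K * ((norm (F k x - f x))\<^sup>2 / c k + c k * (norm (g x))\<^sup>2))"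
      by (intro set_integrable_mult_right set_integral_add(1) set_integrable_divide L2_on_norm_sq d g)
    have "(LINT x:S|lborel. b (F k x) (g x)) - (LINT x:S|lborel. b (f x) (g x))
        = (LINT x:S|lborel. b (F k x - f x) (g x))"
      by (subst set_integral_diff(2)[symmetric])
         (simp_all add: L2_on_bilinear_integrable[OF b F g] L2_on_bilinear_integrable[OF b f g] diff_left)
    also have "norm \<dots> \<le> (LINT x:S|lborel. norm (b (F k x - f x) (g x)))"
      by (rule set_integral_norm_bound[OF i])
    also have "\<dots> \<le> (LINT x:S|lborel. K * ((norm (F k x - f x))\<^sup>2 / c k + c k * (norm (g x))\<^sup>2))"
    proof (intro set_integral_mono set_integrable_norm[OF i] r)
      fix x
      define p q where "p = norm (F k x - f x)" and "q = norm (g x)"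
      have "0 \<le> (p - c k * q)\<^sup>2 + p * (c k * q) + 0"
        using c0[of k] by (intro add_nonneg_nonneg) (auto simp: p_def q_def)
      then have "p * q * c k \<le> p\<^sup>2 + (c k * q)\<^sup>2"
        by (simp add: power2_eq_square algebra_simps)
      then have "p * q \<le> p\<^sup>2 / c k + c k * q\<^sup>2"
        using c0[of k] by (simp add: field_simps power2_eq_square)
      then have "p * q * K \<le> K * (p\<^sup>2 / c k + c k * q\<^sup>2)"
        using K(1) by (subst mult.commute, intro mult_left_mono) auto
      with K(2)[of "F k x - f x" "g x"]
      show "norm (b (F k x - f x) (g x)) \<le> K * ((norm (F k x - f x))\<^sup>2 / c k + c k * (norm (g x))\<^sup>2)"
        unfolding p_def q_def by linarith
    qed
    also have "\<dots> = K * (e k / c k + c k * G)"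
      unfolding set_integral_mult_right
      by (subst set_integral_add(2))
         (simp_all add: e_def G_def set_integrable_divide L2_on_norm_sq d g)
    also have "\<dots> \<le> K * (sqrt (e k) + c k * G)"
    proof -
      have "e k \<le> sqrt (e k) * c k"
        using e0[of k] by (simp add: c_def algebra_simps)
      then have "e k / c k \<le> sqrt (e k)" using c0[of k] by (simp add: field_simps)
      then show ?thesis using K(1) by simp
    qed
    finally show ?thesis .
  qed
  note bound = this
  have "(\<lambda>k. K * (sqrt (e k) + c k * G)) \<longlonglongrightarrow> K * (sqrt 0 + (sqrt 0 + 0) * G)"
    unfolding c_def using lim[folded e_def]
    by (intro tendsto_intros LIMSEQ_inverse_real_of_nat)
  then have "(\<lambda>k. K * (sqrt (e k) + c k * G)) \<longlonglongrightarrow> 0" by simp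
  from Lim_null_comparison[OF always_eventually[OF allI[OF bound]] this]
  show ?thesis by (rule LIM_zero_cancel)
qed

text \<open>By |F|^2 = |F - f|^2 + 2 F.f - |f|^2, convergence of the norms reduces to convergence
  against the fixed function \<open>f\<close>.\<close>

lemma L2_on_norm_limit:
  fixes f :: "'a::euclidean_space \<Rightarrow> 'b::euclidean_space"
  assumes F: "\<And>k::nat. L2_on S (F k)" and f: "L2_on S f"
    and lim: "(\<lambda>k. LINT x:S|lborel. (norm (F k x - f x))\<^sup>2) \<longlonglongrightarrow> 0"
  shows "(\<lambda>k. LINT x:S|lborel. (norm (F k x))\<^sup>2) \<longlonglongrightarrow> (LINT x:S|lborel. (norm (f x))\<^sup>2)"
proof -
  have eq: "(LINT x:S|lborel. (norm (F k x))\<^sup>2) =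
      (LINT x:S|lborel. (norm (F k x - f x))\<^sup>2) + 2 * (LINT x:S|lborel. F k x \<bullet> f x)
        - (LINT x:S|lborel. (norm (f x))\<^sup>2)" for k
  proof -
    have "(LINT x:S|lborel. (norm (F k x))\<^sup>2) =
      (LINT x:S|lborel. ((norm (F k x - f x))\<^sup>2 + 2 * (F k x \<bullet> f x)) - (norm (f x))\<^sup>2)"
      by (simp add: power2_norm_eq_inner algebra_simps inner_commute)
    also have "\<dots> = (LINT x:S|lborel. (norm (F k x - f x))\<^sup>2) + (LINT x:S|lborel. 2 * (F k x \<bullet> f x))
        - (LINT x:S|lborel. (norm (f x))\<^sup>2)"
    proof -
      have i: "set_integrable lborel S (\<lambda>x. (norm (F k x - f x))\<^sup>2)"
        "set_integrable lborel S (\<lambda>x. 2 * (F k x \<bullet> f x))"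
        by (intro L2_on_norm_sq L2_on_diff F f set_integrable_mult_right
            L2_on_bilinear_integrable[OF bounded_bilinear_inner])+
      show ?thesis
        unfolding set_integral_diff(2)[OF set_integral_add(1)[OF i] L2_on_norm_sq[OF f]]
          set_integral_add(2)[OF i] ..
    qed
    finally show ?thesis by simp
  qed
  have "(\<lambda>k. (LINT x:S|lborel. (norm (F k x - f x))\<^sup>2) + 2 * (LINT x:S|lborel. F k x \<bullet> f x)
        - (LINT x:S|lborel. (norm (f x))\<^sup>2)) \<longlonglongrightarrow>
      0 + 2 * (LINT x:S|lborel. f x \<bullet> f x) - (LINT x:S|lborel. (norm (f x))\<^sup>2)"
    by (intro tendsto_intros lim L2_on_bilinear_limit[OF bounded_bilinear_inner F f f lim])
  then show ?thesis unfolding eq by (simp add: power2_norm_eq_inner)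
qed

lemma set_integral_norm_sq_eq_0D:
  fixes f :: "'a::euclidean_space \<Rightarrow> 'b::euclidean_space"
  assumes f: "L2_on S f" and 0: "(LINT x:S|lborel. (norm (f x))\<^sup>2) = 0"
  shows "AE x in lborel. x \<in> S \<longrightarrow> f x = 0"
proof -
  have "AE x in lborel. indicator S x *\<^sub>R (norm (f x))\<^sup>2 = 0"
    using L2_on_norm_sq[OF f] 0 unfolding set_integrable_def set_lebesgue_integral_def
    by (subst integral_nonneg_eq_0_iff_AE[symmetric]) simp_all
  then show ?thesis by eventually_elim (auto simp: indicator_def split: if_splits)
qed

subsection \<open>The divergence theorem on the disc\<close>

text \<open>The fundamental theorem of calculus on the chord at height \<open>c\<close>, with
  finitely many points exempt from differentiability because \<open>G\<close> is continuous. For |c|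
  > 1 the chord is empty and the indicator is 0; for |c| = 1 both ends coincide.\<close>

lemma chord_integral:
  fixes G H :: "real \<Rightarrow> 'a::euclidean_space"
  assumes cont: "\<bar>c\<bar> \<le> 1 \<Longrightarrow> continuous_on {- sqrt (1 - c\<^sup>2)..sqrt (1 - c\<^sup>2)} G"
    and "finite S"
    and der: "\<And>t. t\<^sup>2 + c\<^sup>2 < 1 \<Longrightarrow> t \<notin> S \<Longrightarrow> (G has_vector_derivative H t) (at t)"
    and int: "set_integrable lborel {t. t\<^sup>2 + c\<^sup>2 < 1} H"
  shows "(LINT t:{t. t\<^sup>2 + c\<^sup>2 < 1}|lborel. H t) =
    indicator {-1..1} c *\<^sub>R (G (sqrt (1 - c\<^sup>2)) - G (- sqrt (1 - c\<^sup>2)))"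
proof (cases "\<bar>c\<bar> \<le> 1")
  case True
  define L where "L = sqrt (1 - c\<^sup>2)"
  have c2: "c\<^sup>2 \<le> 1" using True by (simp add: abs_square_le_1)
  have L0: "0 \<le> L" and L2: "L\<^sup>2 = 1 - c\<^sup>2" using c2 by (auto simp: L_def)
  have "t\<^sup>2 + c\<^sup>2 < 1 \<longleftrightarrow> \<bar>t\<bar> < L" for t
  proof -
    have "t\<^sup>2 + c\<^sup>2 < 1 \<longleftrightarrow> t\<^sup>2 < L\<^sup>2" using L2 by auto
    also have "\<dots> \<longleftrightarrow> \<bar>t\<bar> < \<bar>L\<bar>" using abs_le_square_iff[of L t] by linarith
    finally show ?thesis using L0 by simp
  qed
  then have S: "{t. t\<^sup>2 + c\<^sup>2 < 1} = {-L<..<L}" by (intro set_eqI) (simp add: abs_less_iff, linarith)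
  have "(H has_integral G L - G (- L)) {-L..L}"
  proof (rule fundamental_theorem_of_calculus_interior_strong[OF \<open>finite S\<close>])
    fix t assume t: "t \<in> {-L<..<L} - S"
    then have "t \<in> {t. t\<^sup>2 + c\<^sup>2 < 1}" unfolding S by blast
    with t show "(G has_vector_derivative H t) (at t)"
      by (intro der) blast+
  next
    show "- L \<le> L" using L0 by simp
    show "continuous_on {-L..L} G" unfolding L_def by (rule cont[OF True])
  qed
  then have "integral {-L<..<L} H = G L - G (- L)"
    by (intro integral_unique has_integral_Icc_iff_Ioo[THEN iffD1])
  moreover have "(LINT t:{-L<..<L}|lborel. H t) = integral {-L<..<L} H"
    using int unfolding S by (rule set_borel_integral_eq_integral(2))
  ultimately show ?thesis
    unfolding S L_def[symmetric] using True by (simp add: abs_le_iff)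
next
  case False
  then have "\<not> c\<^sup>2 \<le> 1" by (simp add: abs_square_le_1)
  then have "\<not> t\<^sup>2 + c\<^sup>2 < 1" for t using zero_le_power2[of t] by linarith
  with False show ?thesis by (auto simp: set_lebesgue_integral_def indicator_def abs_le_iff)
qed

lemma sqrt_one_minus_sq: "\<bar>x\<bar> \<le> 1 \<Longrightarrow> (sqrt (1 - x\<^sup>2))\<^sup>2 = 1 - (x::real)\<^sup>2"
  by (simp add: abs_square_le_1)

text \<open>Fubini reduces the integral to vertical chords, on which the fundamental theorem
  applies.\<close>

lemma disc_integral_deriv_y:
  fixes F f :: "real \<times> real \<Rightarrow> 'a::euclidean_space"
  assumes cont: "continuous_on (cball 0 1) F"
    and int: "set_integrable lborel disc f"
    and fin: "\<And>x. finite {y. (x, y) \<in> N}"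
    and der: "\<And>x y. (x, y) \<in> disc \<Longrightarrow> (x, y) \<notin> N \<Longrightarrow>
      ((\<lambda>t. F (x, t)) has_vector_derivative f (x, y)) (at y)"
  shows "(LINT p:disc|lborel. f p) =
    integral {-1..1} (\<lambda>x. F (x, sqrt (1 - x\<^sup>2)) - F (x, - sqrt (1 - x\<^sup>2)))" (is "_ = integral _ ?g")
proof -
  have i: "integrable (lborel \<Otimes>\<^sub>M lborel) (\<lambda>p. indicator disc p *\<^sub>R f p)"
    using int by (simp add: set_integrable_def lborel_prod)
  have ind: "indicator disc (x, y) = indicator {t. t\<^sup>2 + x\<^sup>2 < 1} y" for x y
    by (auto simp: indicator_def norm_Pair add.commute)
  have "continuous_on {-1..1} ?g"
    by (intro continuous_intros continuous_on_compose2[OF cont])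
       (auto simp: norm_Pair sqrt_one_minus_sq abs_le_iff)
  then have gi: "set_integrable lborel {-1..1} ?g"
    unfolding set_integrable_def by (intro borel_integrable_compact) auto
  have "(LINT p:disc|lborel. f p) = (\<integral>p. indicator disc p *\<^sub>R f p \<partial>(lborel \<Otimes>\<^sub>M lborel))"
    by (simp add: set_lebesgue_integral_def lborel_prod)
  also have "\<dots> = (\<integral>x. (\<integral>y. indicator disc (x, y) *\<^sub>R f (x, y) \<partial>lborel) \<partial>lborel)"
    by (rule lborel_pair.integral_fst'[OF i, symmetric])
  also have "\<dots> = (\<integral>x. indicator {-1..1} x *\<^sub>R ?g x \<partial>lborel)"
  proof (rule integral_cong_AE)
    show "(\<lambda>x. \<integral>y. indicator disc (x, y) *\<^sub>R f (x, y) \<partial>lborel) \<in> borel_measurable lborel"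
      using lborel_pair.integrable_fst'[OF i] by (rule borel_measurable_integrable)
    show "(\<lambda>x. indicator {-1..1} x *\<^sub>R ?g x) \<in> borel_measurable lborel"
      using gi unfolding set_integrable_def by (rule borel_measurable_integrable)
    \<comment> \<open>Fubini makes \<open>f\<close> integrable along almost every chord only, so the
      inner integrals are identified almost everywhere.\<close>
    from lborel_pair.AE_integrable_fst'[OF i]
    show "AE x in lborel. (\<integral>y. indicator disc (x, y) *\<^sub>R f (x, y) \<partial>lborel) = indicator {-1..1} x *\<^sub>R ?g x"
    proof eventually_elim
      fix x assume x: "integrable lborel (\<lambda>y. indicator disc (x, y) *\<^sub>R f (x, y))"
      show "(\<integral>y. indicator disc (x, y) *\<^sub>R f (x, y) \<partial>lborel) = indicator {-1..1} x *\<^sub>R ?g x"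
        unfolding ind set_lebesgue_integral_def[symmetric]
      proof (rule chord_integral[OF _ fin])
        assume "\<bar>x\<bar> \<le> 1"
        then show "continuous_on {- sqrt (1 - x\<^sup>2)..sqrt (1 - x\<^sup>2)} (\<lambda>y. F (x, y))"
        proof (intro continuous_on_compose2[OF cont] continuous_intros subsetI)
          fix p assume "p \<in> Pair x ` {- sqrt (1 - x\<^sup>2)..sqrt (1 - x\<^sup>2)}"
          then obtain t where t: "p = (x, t)" "\<bar>t\<bar> \<le> sqrt (1 - x\<^sup>2)" by auto
          then show "p \<in> cball 0 1" using sqrt_ge_absD[OF t(2)] by (simp add: norm_Pair)
        qed
      next
        show "set_integrable lborel {t. t\<^sup>2 + x\<^sup>2 < 1} (\<lambda>y. f (x, y))"
          using x by (simp add: set_integrable_def ind)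
        show "((\<lambda>y. F (x, y)) has_vector_derivative f (x, t)) (at t)"
          if "t\<^sup>2 + x\<^sup>2 < 1" "t \<notin> {y. (x, y) \<in> N}" for t
          using that by (intro der) (auto simp: norm_Pair add.commute)
      qed
    qed
  qed
  also have "\<dots> = integral {-1..1} ?g"
    using set_borel_integral_eq_integral(2)[OF gi] by (simp add: set_lebesgue_integral_def)
  finally show ?thesis .
qed

text \<open>The disc and Lebesgue measure are invariant under exchange of the coordinates, which
  reduces this to vertical chords.\<close>

lemma disc_integral_deriv_x:
  fixes F f :: "real \<times> real \<Rightarrow> 'a::euclidean_space"
  assumes cont: "continuous_on (cball 0 1) F"
    and int: "set_integrable lborel disc f"
    and fin: "\<And>y. finite {x. (x, y) \<in> N}"
    and der: "\<And>x y. (x, y) \<in> disc \<Longrightarrow> (x, y) \<notin> N \<Longrightarrow>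
      ((\<lambda>t. F (t, y)) has_vector_derivative f (x, y)) (at x)"
  shows "(LINT p:disc|lborel. f p) =
    integral {-1..1} (\<lambda>y. F (sqrt (1 - y\<^sup>2), y) - F (- sqrt (1 - y\<^sup>2), y))"
proof -
  have ind: "indicator disc (y, x) = (indicator disc (x, y) :: real)" for x y :: real
    by (auto simp: indicator_def norm_Pair add.commute)
  have i: "integrable (lborel \<Otimes>\<^sub>M lborel) (\<lambda>p. indicator disc p *\<^sub>R f p)"
    using int by (simp add: set_integrable_def lborel_prod)
  have "(LINT p:disc|lborel. f p) = (\<integral>p. indicator disc p *\<^sub>R f p \<partial>(lborel \<Otimes>\<^sub>M lborel))"
    by (simp add: set_lebesgue_integral_def lborel_prod)
  also have "\<dots> = (\<integral>(x, y). indicator disc (y, x) *\<^sub>R f (y, x) \<partial>(lborel \<Otimes>\<^sub>M lborel))"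
    by (rule lborel_pair.integral_product_swap[symmetric]) (use i in \<open>simp\<close>)
  also have "\<dots> = (LINT p:disc|lborel. f (prod.swap p))"
    by (simp add: set_lebesgue_integral_def lborel_prod ind case_prod_unfold prod.swap_def)
  also have "\<dots> = integral {-1..1} (\<lambda>y. F (prod.swap (y, sqrt (1 - y\<^sup>2))) - F (prod.swap (y, - sqrt (1 - y\<^sup>2))))"
  proof (rule disc_integral_deriv_y[where N = "prod.swap ` N"])
    show "continuous_on (cball 0 1) (\<lambda>p. F (prod.swap p))"
      by (intro continuous_on_compose2[OF cont] continuous_on_swap)
         (auto simp: norm_Pair add.commute)
    have "integrable (lborel \<Otimes>\<^sub>M lborel) (\<lambda>(x, y). indicator disc (y, x) *\<^sub>R f (y, x))"
      by (rule lborel_pair.integrable_product_swap) (use i in \<open>simp\<close>)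
    then show "set_integrable lborel disc (\<lambda>p. f (prod.swap p))"
      by (simp add: set_integrable_def lborel_prod ind case_prod_unfold prod.swap_def)
    show "finite {y. (x, y) \<in> prod.swap ` N}" for x
      using fin[of x] by (rule finite_subset[rotated]) auto
    show "((\<lambda>t. F (prod.swap (x, t))) has_vector_derivative f (prod.swap (x, y))) (at y)"
      if "(x, y) \<in> disc" "(x, y) \<notin> prod.swap ` N" for x y
      using that der[of y x] by (force simp: norm_Pair add.commute)
  qed
  finally show ?thesis by simp
qed

text \<open>An antiderivative \<open>P\<close> of \<open>g\<close> is composed with sin or cos and
  differentiated by the chain rule, so no monotone substitution is needed. The intervals are those
  on which the weight sin or cos keeps its sign; the right half circle comes in two pieces because
  the angle starts at 0.\<close>

lemma has_integral_sin_cos_substitution: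
  fixes g :: "real \<Rightarrow> 'a::euclidean_space"
  assumes "continuous_on {-1..1} g"
  shows "((\<lambda>t. sin t *\<^sub>R g (cos t)) has_integral integral {-1..1} g) {0..pi}"
    and "((\<lambda>t. sin t *\<^sub>R g (cos t)) has_integral - integral {-1..1} g) {pi..2*pi}"
    and "((\<lambda>t. cos t *\<^sub>R g (sin t)) has_integral integral {0..1} g) {0..pi/2}"
    and "((\<lambda>t. cos t *\<^sub>R g (sin t)) has_integral - integral {-1..1} g) {pi/2..3*pi/2}"
    and "((\<lambda>t. cos t *\<^sub>R g (sin t)) has_integral integral {-1..0} g) {3*pi/2..2*pi}"
proof -
  define P where "P = (\<lambda>u. integral {-1..u} g)"
  have P: "(P has_vector_derivative g u) (at u within {-1..1})" if "u \<in> {-1..1}" for u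
    unfolding P_def using integral_has_vector_derivative[OF assms that] .
  have s: "((\<lambda>t. P (sin t)) has_vector_derivative cos t *\<^sub>R g (sin t)) (at t within T)" for t T
  proof -
    have "(sin has_vector_derivative cos t) (at t within T)"
      by (auto simp: has_real_derivative_iff_has_vector_derivative[symmetric]
          intro!: derivative_eq_intros)
    moreover have "(P has_vector_derivative g (sin t)) (at (sin t) within sin ` T)"
      by (rule has_vector_derivative_within_subset[OF P]) auto
    ultimately show ?thesis using vector_diff_chain_within by (fastforce simp: o_def)
  qed
  have c: "((\<lambda>t. P (cos t)) has_vector_derivative - sin t *\<^sub>R g (cos t)) (at t within T)" for t T
  proof -
    have "(cos has_vector_derivative - sin t) (at t within T)"
      by (auto simp: has_real_derivative_iff_has_vector_derivative[symmetric]
          intro!: derivative_eq_intros)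
    moreover have "(P has_vector_derivative g (cos t)) (at (cos t) within cos ` T)"
      by (rule has_vector_derivative_within_subset[OF P]) auto
    ultimately show ?thesis using vector_diff_chain_within by (fastforce simp: o_def)
  qed
  have P1: "P (-1) = 0" "P 1 = integral {-1..1} g" by (simp_all add: P_def)
  have P0: "P 1 - P 0 = integral {0..1} g" "P 0 = integral {-1..0} g"
    using Henstock_Kurzweil_Integration.integral_combine[where a = "-1" and c = 0 and b = 1 and f = g] integrable_continuous_real[OF assms]
    by (auto simp: P_def algebra_simps)
  have s3: "sin (3 * pi / 2) = -1" using sin_3over2_pi by (simp add: mult.commute)
  have ic: "((\<lambda>t. sin t *\<^sub>R g (cos t)) has_integral P (cos a) - P (cos b)) {a..b}" if "a \<le> b" for a b
    using has_integral_neg[OF fundamental_theorem_of_calculus[OF that c]] by simp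
  have si: "((\<lambda>t. cos t *\<^sub>R g (sin t)) has_integral P (sin b) - P (sin a)) {a..b}" if "a \<le> b" for a b
    using fundamental_theorem_of_calculus[OF that s] by simp
  show "((\<lambda>t. sin t *\<^sub>R g (cos t)) has_integral integral {-1..1} g) {0..pi}"
    "((\<lambda>t. sin t *\<^sub>R g (cos t)) has_integral - integral {-1..1} g) {pi..2*pi}"
    using ic[of 0 pi] ic[of pi "2 * pi"] by (auto simp: P1)
  show "((\<lambda>t. cos t *\<^sub>R g (sin t)) has_integral integral {0..1} g) {0..pi/2}"
    "((\<lambda>t. cos t *\<^sub>R g (sin t)) has_integral - integral {-1..1} g) {pi/2..3*pi/2}"
    "((\<lambda>t. cos t *\<^sub>R g (sin t)) has_integral integral {-1..0} g) {3*pi/2..2*pi}"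
    using si[of 0 "pi/2"] si[of "pi/2" "3*pi/2"] si[of "3*pi/2" "2*pi"]
    by (simp_all add: P1 P0 s3 flip: P0(1))
qed


text \<open>The right and left half circles are the graphs x = sqrt(1 - y^2) and x = - sqrt(1 -
  y^2). With y = sin t the root is |cos t|, so the sign of cos t selects the arc, and the weight cos
  t is the x-component of the outward normal.\<close>

lemma disc_divergence_x:
  fixes F f :: "real \<times> real \<Rightarrow> 'a::euclidean_space"
  assumes cont: "continuous_on (cball 0 1) F"
    and int: "set_integrable lborel disc f"
    and fin: "\<And>y. finite {x. (x, y) \<in> N}"
    and der: "\<And>x y. (x, y) \<in> disc \<Longrightarrow> (x, y) \<notin> N \<Longrightarrow>
      ((\<lambda>t. F (t, y)) has_vector_derivative f (x, y)) (at x)"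
  shows "(LINT p:disc|lborel. f p) = (LINT t:{0..2*pi}|lborel. cos t *\<^sub>R F (cos t, sin t))"
proof -
  define g h where "g = (\<lambda>y. F (sqrt (1 - y\<^sup>2), y))" and "h = (\<lambda>y. F (- sqrt (1 - y\<^sup>2), y))"
  have c: "continuous_on {-1..1} g" "continuous_on {-1..1} h"
    unfolding g_def h_def
    by (intro continuous_intros continuous_on_compose2[OF cont];
        auto simp: norm_Pair sqrt_one_minus_sq abs_le_iff)+
  note i = integrable_continuous_real[OF c(1)] integrable_continuous_real[OF c(2)]
  have sq: "1 - (sin t)\<^sup>2 = (cos t)\<^sup>2" for t :: real
    using sin_cos_squared_add[of t] by linarith
  let ?G = "\<lambda>t. cos t *\<^sub>R F (cos t, sin t)"
  have 1: "(?G has_integral integral {0..1} g) {0..pi/2}"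
  proof (rule has_integral_eq[OF _ has_integral_sin_cos_substitution(3)[OF c(1)]])
    fix t assume "t \<in> {0..pi/2}"
    then have "0 \<le> cos t" by (intro cos_ge_zero) auto
    then show "cos t *\<^sub>R g (sin t) = ?G t" by (simp add: g_def sq)
  qed
  have 2: "(?G has_integral - integral {-1..1} h) {pi/2..3*pi/2}"
  proof (rule has_integral_eq[OF _ has_integral_sin_cos_substitution(4)[OF c(2)]])
    fix t assume "t \<in> {pi/2..3*pi/2}"
    then have "0 \<le> cos (t - pi)" by (intro cos_ge_zero) auto
    then have "cos t \<le> 0" by (simp add: cos_diff)
    then show "cos t *\<^sub>R h (sin t) = ?G t" by (simp add: h_def sq)
  qed
  have 3: "(?G has_integral integral {-1..0} g) {3*pi/2..2*pi}"
  proof (rule has_integral_eq[OF _ has_integral_sin_cos_substitution(5)[OF c(1)]])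
    fix t assume "t \<in> {3*pi/2..2*pi}"
    then have "0 \<le> cos (t - 2 * pi)" by (intro cos_ge_zero) auto
    then have "0 \<le> cos t" by (simp add: cos_diff)
    then show "cos t *\<^sub>R g (sin t) = ?G t" by (simp add: g_def sq)
  qed
  have "(?G has_integral integral {0..1} g + - integral {-1..1} h + integral {-1..0} g) {0..2*pi}"
    by (rule has_integral_combine[OF _ _ has_integral_combine[OF _ _ 1 2] 3])
       (simp_all add: field_simps)
  moreover have "integral {0..1} g + - integral {-1..1} h + integral {-1..0} g
      = integral {-1..1} (\<lambda>y. g y - h y)"
    using Henstock_Kurzweil_Integration.integral_combine[where a = "-1" and c = 0 and b = 1 and f = g]
      integral_diff[OF i] i by (simp add: add.commute[of "integral {0..1} g"])
  moreover have "set_integrable lborel {0..2*pi} ?G"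
    unfolding set_integrable_def
    by (intro borel_integrable_compact continuous_intros continuous_on_compose2[OF cont])
       (auto simp: norm_Pair)
  ultimately show ?thesis
    using disc_integral_deriv_x[OF cont int fin der]
    by (simp add: set_borel_integral_eq_integral(2) integral_unique g_def h_def)
qed

lemma disc_divergence_y:
  fixes F f :: "real \<times> real \<Rightarrow> 'a::euclidean_space"
  assumes cont: "continuous_on (cball 0 1) F"
    and int: "set_integrable lborel disc f"
    and fin: "\<And>x. finite {y. (x, y) \<in> N}"
    and der: "\<And>x y. (x, y) \<in> disc \<Longrightarrow> (x, y) \<notin> N \<Longrightarrow>
      ((\<lambda>t. F (x, t)) has_vector_derivative f (x, y)) (at y)"
  shows "(LINT p:disc|lborel. f p) = (LINT t:{0..2*pi}|lborel. sin t *\<^sub>R F (cos t, sin t))"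
proof -
  define g h where "g = (\<lambda>x. F (x, sqrt (1 - x\<^sup>2)))" and "h = (\<lambda>x. F (x, - sqrt (1 - x\<^sup>2)))"
  have c: "continuous_on {-1..1} g" "continuous_on {-1..1} h"
    unfolding g_def h_def
    by (intro continuous_intros continuous_on_compose2[OF cont];
        auto simp: norm_Pair sqrt_one_minus_sq abs_le_iff)+
  note i = integrable_continuous_real[OF c(1)] integrable_continuous_real[OF c(2)]
  have sq: "1 - (cos t)\<^sup>2 = (sin t)\<^sup>2" for t :: real
    using sin_cos_squared_add[of t] by linarith
  let ?G = "\<lambda>t. sin t *\<^sub>R F (cos t, sin t)"
  have 1: "(?G has_integral integral {-1..1} g) {0..pi}"
  proof (rule has_integral_eq[OF _ has_integral_sin_cos_substitution(1)[OF c(1)]])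
    fix t assume "t \<in> {0..pi}"
    then have "0 \<le> sin t" by (intro sin_ge_zero) auto
    then show "sin t *\<^sub>R g (cos t) = ?G t" by (simp add: g_def sq)
  qed
  have 2: "(?G has_integral - integral {-1..1} h) {pi..2*pi}"
  proof (rule has_integral_eq[OF _ has_integral_sin_cos_substitution(2)[OF c(2)]])
    fix t assume "t \<in> {pi..2*pi}"
    then have "0 \<le> sin (t - pi)" by (intro sin_ge_zero) auto
    then have "sin t \<le> 0" by (simp add: sin_diff)
    then show "sin t *\<^sub>R h (cos t) = ?G t" by (simp add: h_def sq)
  qed
  have "(?G has_integral integral {-1..1} g + - integral {-1..1} h) {0..2*pi}"
    by (rule has_integral_combine[OF _ _ 1 2]) simp_all
  moreover have "set_integrable lborel {0..2*pi} ?G"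
    unfolding set_integrable_def
    by (intro borel_integrable_compact continuous_intros continuous_on_compose2[OF cont])
       (auto simp: norm_Pair)
  ultimately show ?thesis
    using disc_integral_deriv_y[OF cont int fin der] integral_diff[OF i]
    by (simp add: set_borel_integral_eq_integral(2) integral_unique g_def h_def)
qed

lemma disc_divergence:
  fixes P Q p q :: "real \<times> real \<Rightarrow> 'a::euclidean_space"
  assumes "continuous_on (cball 0 1) P" "continuous_on (cball 0 1) Q"
    and "set_integrable lborel disc p" "set_integrable lborel disc q"
    and "\<And>y. finite {x. (x, y) \<in> N}" "\<And>x. finite {y. (x, y) \<in> N}"
    and "\<And>x y. (x, y) \<in> disc \<Longrightarrow> (x, y) \<notin> N \<Longrightarrow>
      ((\<lambda>t. P (t, y)) has_vector_derivative p (x, y)) (at x)"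
    and "\<And>x y. (x, y) \<in> disc \<Longrightarrow> (x, y) \<notin> N \<Longrightarrow>
      ((\<lambda>t. Q (x, t)) has_vector_derivative q (x, y)) (at y)"
  shows "(LINT z:disc|lborel. p z + q z) =
    (LINT t:{0..2*pi}|lborel. cos t *\<^sub>R P (cos t, sin t) + sin t *\<^sub>R Q (cos t, sin t))"
proof -
  have 1: "set_integrable lborel {0..2*pi} (\<lambda>t. cos t *\<^sub>R P (cos t, sin t))"
    unfolding set_integrable_def
    by (intro borel_integrable_compact continuous_intros continuous_on_compose2[OF assms(1)])
       (auto simp: norm_Pair)
  have 2: "set_integrable lborel {0..2*pi} (\<lambda>t. sin t *\<^sub>R Q (cos t, sin t))"
    unfolding set_integrable_def
    by (intro borel_integrable_compact continuous_intros continuous_on_compose2[OF assms(2)])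
       (auto simp: norm_Pair)
  show ?thesis
    unfolding set_integral_add(2)[OF assms(3,4)] set_integral_add(2)[OF 1 2]
    using disc_divergence_x[OF assms(1,3,5,7)] disc_divergence_y[OF assms(2,4,6,8)] by simp
qed

subsection \<open>A Poincare inequality\<close>

lemma C1_on_continuous: "C1_on S f Df \<Longrightarrow> continuous_on S f"
  unfolding C1_on_def
  by (rule has_derivative_continuous_on
      [where f' = "\<lambda>x h. fst h *\<^sub>R fst (Df x) + snd h *\<^sub>R snd (Df x)"]) blast

lemma C1_on_partials:
  assumes "C1_on S f Df" "(x, y) \<in> interior S"
  shows "((\<lambda>t. f (t, y)) has_vector_derivative fst (Df (x, y))) (at x)"
    and "((\<lambda>t. f (x, t)) has_vector_derivative snd (Df (x, y))) (at y)"
proof -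
  have f: "(f has_derivative (\<lambda>h. fst h *\<^sub>R fst (Df (x, y)) + snd h *\<^sub>R snd (Df (x, y)))) (at (x, y))"
    using bspec[OF conjunct1[OF assms(1)[unfolded C1_on_def]] subsetD[OF interior_subset assms(2)]]
    unfolding at_within_interior[OF assms(2)] .
  have "((\<lambda>t. (t, y)) has_derivative (\<lambda>h. (h, 0))) (at x)"
    "((\<lambda>t. (x, t)) has_derivative (\<lambda>h. (0, h))) (at y)"
    by (intro has_derivative_Pair has_derivative_ident has_derivative_const)+
  from has_derivative_compose[OF this(1) f] has_derivative_compose[OF this(2) f]
  show "((\<lambda>t. f (t, y)) has_vector_derivative fst (Df (x, y))) (at x)"
    "((\<lambda>t. f (x, t)) has_vector_derivative snd (Df (x, y))) (at y)"
    by (simp_all add: has_vector_derivative_def)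
qed

lemma C1_on_diff:
  assumes "C1_on S f Df" "C1_on S g Dg"
  shows "C1_on S (\<lambda>x. f x - g x) (\<lambda>x. Df x - Dg x)"
  using assms unfolding C1_on_def
  by (auto intro!: continuous_intros derivative_eq_intros simp: scaleR_diff_right)

lemma set_integrable_disc:
  fixes f :: "real \<times> real \<Rightarrow> 'a::euclidean_space"
  assumes "continuous_on (cball 0 1) f"
  shows "set_integrable lborel disc f"
proof (rule set_integrable_subset)
  show "set_integrable lborel (cball 0 1) f"
    unfolding set_integrable_def by (intro borel_integrable_compact assms) simp
qed auto

text \<open>The divergence of the field \<open>x \<mapsto> |\<phi>(x)|\<^sup>2 x\<close> is \<open>2|\<phi>|\<^sup>2 + 2 \<phi> \<bullet> (x \<bullet> \<nabla>\<phi>)\<close>; the last term is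
  at least \<open>- |\<phi>|\<^sup>2 - |x|\<^sup>2 |\<nabla>\<phi>|\<^sup>2\<close>.\<close>

lemma disc_poincare:
  assumes \<phi>: "C1_on (cball 0 1) \<phi> D\<phi>"
  shows "(LINT z:disc|lborel. (norm (\<phi> z))\<^sup>2) \<le>
    (LINT t:{0..2*pi}|lborel. (norm (\<phi> (cos t, sin t)))\<^sup>2) +
    (LINT z:disc|lborel. (norm (norm z *\<^sub>R D\<phi> z))\<^sup>2)"
proof -
  have c: "continuous_on (cball 0 1) \<phi>" "continuous_on (cball 0 1) D\<phi>"
    using \<phi> C1_on_continuous by (auto simp: C1_on_def)
  let ?p = "\<lambda>z. \<phi> z \<bullet> \<phi> z + 2 * fst z * (\<phi> z \<bullet> fst (D\<phi> z))"
  let ?q = "\<lambda>z. \<phi> z \<bullet> \<phi> z + 2 * snd z * (\<phi> z \<bullet> snd (D\<phi> z))"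
  have i: "set_integrable lborel disc ?p" "set_integrable lborel disc ?q"
    by (intro set_integrable_disc continuous_intros c)+
  have "(LINT z:disc|lborel. ?p z + ?q z) =
    (LINT t:{0..2*pi}|lborel. cos t *\<^sub>R (fst (cos t, sin t) * (\<phi> (cos t, sin t) \<bullet> \<phi> (cos t, sin t))) +
      sin t *\<^sub>R (snd (cos t, sin t) * (\<phi> (cos t, sin t) \<bullet> \<phi> (cos t, sin t))))"
  proof (rule disc_divergence[where N = "{}" and P = "\<lambda>z. fst z * (\<phi> z \<bullet> \<phi> z)"
        and Q = "\<lambda>z. snd z * (\<phi> z \<bullet> \<phi> z)", OF _ _ i])
    show "continuous_on (cball 0 1) (\<lambda>z. fst z * (\<phi> z \<bullet> \<phi> z))"
      "continuous_on (cball 0 1) (\<lambda>z. snd z * (\<phi> z \<bullet> \<phi> z))"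
      by (intro continuous_intros c)+
    fix x y :: real assume "(x, y) \<in> disc"
    then have "(x, y) \<in> interior (cball 0 1)" by simp
    note d = C1_on_partials[OF \<phi> this]
    have "((\<lambda>t. \<phi> (t, y) \<bullet> \<phi> (t, y)) has_real_derivative 2 * (\<phi> (x, y) \<bullet> fst (D\<phi> (x, y)))) (at x)"
      "((\<lambda>t. \<phi> (x, t) \<bullet> \<phi> (x, t)) has_real_derivative 2 * (\<phi> (x, y) \<bullet> snd (D\<phi> (x, y)))) (at y)"
      using bounded_bilinear.has_vector_derivative[OF bounded_bilinear_inner d(1) d(1)]
        bounded_bilinear.has_vector_derivative[OF bounded_bilinear_inner d(2) d(2)]
      by (simp_all add: has_real_derivative_iff_has_vector_derivative inner_commute)
    from DERIV_mult[OF DERIV_ident this(1)] DERIV_mult[OF DERIV_ident this(2)]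
    show "((\<lambda>t. fst (t, y) * (\<phi> (t, y) \<bullet> \<phi> (t, y))) has_vector_derivative ?p (x, y)) (at x)"
      "((\<lambda>t. snd (x, t) * (\<phi> (x, t) \<bullet> \<phi> (x, t))) has_vector_derivative ?q (x, y)) (at y)"
      by (simp_all add: has_real_derivative_iff_has_vector_derivative[symmetric] mult_ac add_ac)
  qed auto
  also have "\<dots> = (LINT t:{0..2*pi}|lborel. (norm (\<phi> (cos t, sin t)))\<^sup>2)"
  proof (rule arg_cong[where f = "set_lebesgue_integral _ _"], rule ext)
    fix t :: real
    have "cos t *\<^sub>R (fst (cos t, sin t) * w) + sin t *\<^sub>R (snd (cos t, sin t) * w) = w" for w :: real
      using sin_cos_squared_add[of t] by (simp add: power2_eq_square flip: mult.assoc distrib_right)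
    then show "cos t *\<^sub>R (fst (cos t, sin t) * (\<phi> (cos t, sin t) \<bullet> \<phi> (cos t, sin t))) +
      sin t *\<^sub>R (snd (cos t, sin t) * (\<phi> (cos t, sin t) \<bullet> \<phi> (cos t, sin t))) =
      (norm (\<phi> (cos t, sin t)))\<^sup>2"
      by (simp only: power2_norm_eq_inner)
  qed
  finally have eq: "(LINT z:disc|lborel. ?p z + ?q z) = (LINT t:{0..2*pi}|lborel. (norm (\<phi> (cos t, sin t)))\<^sup>2)" .
  have "(LINT z:disc|lborel. (norm (\<phi> z))\<^sup>2) \<le>
      (LINT z:disc|lborel. (?p z + ?q z) + (norm (norm z *\<^sub>R D\<phi> z))\<^sup>2)"
  proof (rule set_integral_mono)
    show "set_integrable lborel disc (\<lambda>z. (norm (\<phi> z))\<^sup>2)"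
      "set_integrable lborel disc (\<lambda>z. (?p z + ?q z) + (norm (norm z *\<^sub>R D\<phi> z))\<^sup>2)"
      by (intro set_integrable_disc continuous_intros c)+
    fix z :: "real \<times> real"
    define a b where "a = fst (D\<phi> z)" and "b = snd (D\<phi> z)"
    define v where "v = fst z *\<^sub>R a + snd z *\<^sub>R b"
    have "norm v \<le> \<bar>fst z\<bar> * norm a + \<bar>snd z\<bar> * norm b"
      unfolding v_def by (rule norm_triangle_le) simp
    then have "(norm v)\<^sup>2 \<le> (\<bar>fst z\<bar> * norm a + \<bar>snd z\<bar> * norm b)\<^sup>2"
      by (rule power_mono) simp
    \<comment> \<open>The added square completes Lagrange's identity, which turns the sum into the
      product of |z|^2 and the squared norm of the gradient.\<close>
    also have "\<dots> \<le> (\<bar>fst z\<bar> * norm a + \<bar>snd z\<bar> * norm b)\<^sup>2 + (\<bar>fst z\<bar> * norm b - \<bar>snd z\<bar> * norm a)\<^sup>2"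
      by simp
    also have "\<dots> = ((fst z)\<^sup>2 + (snd z)\<^sup>2) * ((norm a)\<^sup>2 + (norm b)\<^sup>2)"
      by (simp add: power2_eq_square algebra_simps flip: abs_mult)
    also have "\<dots> = (norm (norm z *\<^sub>R D\<phi> z))\<^sup>2"
      by (simp add: a_def b_def power_mult_distrib norm_prod_def distrib_left)
    finally have 1: "(norm v)\<^sup>2 \<le> (norm (norm z *\<^sub>R D\<phi> z))\<^sup>2" .
    have "0 \<le> (norm (\<phi> z + v))\<^sup>2" by simp
    also have "\<dots> = \<phi> z \<bullet> \<phi> z + 2 * (\<phi> z \<bullet> v) + (norm v)\<^sup>2"
      by (simp add: power2_norm_eq_inner inner_add_left inner_add_right inner_commute)
    also have "\<dots> = (?p z + ?q z) - \<phi> z \<bullet> \<phi> z + (norm v)\<^sup>2"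
      by (simp add: v_def a_def b_def inner_add_right algebra_simps)
    finally show "(norm (\<phi> z))\<^sup>2 \<le> (?p z + ?q z) + (norm (norm z *\<^sub>R D\<phi> z))\<^sup>2"
      using 1 unfolding power2_norm_eq_inner[of "\<phi> z"] by linarith
  qed
  also have "\<dots> = (LINT z:disc|lborel. ?p z + ?q z) + (LINT z:disc|lborel. (norm (norm z *\<^sub>R D\<phi> z))\<^sup>2)"
    by (rule set_integral_add(2)[OF set_integral_add(1)[OF i]])
       (intro set_integrable_disc continuous_intros c)
  finally show ?thesis unfolding eq .
qed

subsection \<open>Bessel functions\<close>

text \<open>A Bessel-Clifford function, not the modified Bessel function of the second kind: J_n(x)
  = (x/2)^n K_n(x^2/4). It is entire in t, so neither roots nor negative powers appear at the
  origin.\<close>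

definition bessel_K :: "nat \<Rightarrow> real \<Rightarrow> real" where
  "bessel_K n t = (\<Sum>k. (-1) ^ k / (fact k * fact (k + n)) * t ^ k)"

lemma bessel_K_summable: "summable (\<lambda>k. (-1) ^ k / (fact k * fact (k + n)) * (t::real) ^ k)"
proof (rule summable_comparison_test')
  show "summable (\<lambda>k. inverse (fact k) * \<bar>t\<bar> ^ k)" by (rule summable_exp)
  show "norm ((-1) ^ k / (fact k * fact (k + n)) * t ^ k) \<le> inverse (fact k) * \<bar>t\<bar> ^ k" for k
  proof -
    have "inverse (fact k * fact (k + n)) \<le> (inverse (fact k) :: real)"
      using fact_ge_1[of "k + n", where 'a = real] by (simp add: field_simps)
    then show ?thesis
      by (simp add: abs_mult power_abs divide_inverse mult_right_mono)
  qed
qed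

lemma bessel_K_deriv: "(bessel_K n has_real_derivative - bessel_K (Suc n) t) (at t)"
proof -
  let ?c = "\<lambda>k. (-1) ^ k / (fact k * fact (k + n)) :: real"
  have "((\<lambda>t. \<Sum>k. ?c k * t ^ k) has_real_derivative (\<Sum>k. diffs ?c k * t ^ k)) (at t)"
    by (rule termdiffs_strong_converges_everywhere) (rule bessel_K_summable)
  moreover have "diffs ?c = (\<lambda>k. - ((-1) ^ k / (fact k * fact (k + Suc n))))"
    by (rule ext) (simp add: diffs_def field_simps del: of_nat_Suc)
  ultimately show ?thesis
    using suminf_minus[OF bessel_K_summable[of "Suc n" t]] by (simp add: bessel_K_def[abs_def])
qed

lemma bessel_K_continuous: "continuous_on S (bessel_K n)"
  using bessel_K_deriv by (intro continuous_at_imp_continuous_on ballI DERIV_isCont)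

text \<open>In the variable t = x^2/4 this is the classical J_n + J_{n+2} = (2(n+1)/x) J_{n+1}.
  Since differentiation lowers to - K_{n+1}, it also contains Bessel's differential equation. The
  proof compares coefficients.\<close>

lemma bessel_K_rec:
  "bessel_K n t + t * bessel_K (Suc (Suc n)) t = real (Suc n) * bessel_K (Suc n) t"
proof -
  let ?a = "\<lambda>n k. (-1) ^ k / (fact k * fact (k + n)) :: real"
  have a: "(\<lambda>k. ?a n k * t ^ k) sums bessel_K n t" for n
    unfolding bessel_K_def using bessel_K_summable by (rule summable_sums)
  \<comment> \<open>Multiplication by \<open>t\<close> shifts the series by one index, leaving the
    constant coefficient 0.\<close>
  define g where "g = (\<lambda>k. case k of 0 \<Rightarrow> 0 | Suc j \<Rightarrow> t * (?a (Suc (Suc n)) j * t ^ j))"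
  have "g sums (t * bessel_K (Suc (Suc n)) t)"
    using sums_mult[OF a[of "Suc (Suc n)"], of t] sums_Suc_iff[of g] by (simp add: g_def)
  from sums_add[OF a[of n] this]
  have "(\<lambda>k. ?a n k * t ^ k + g k) sums (bessel_K n t + t * bessel_K (Suc (Suc n)) t)" .
  moreover have "?a n k * t ^ k + g k = real (Suc n) * (?a (Suc n) k * t ^ k)" for k
  proof (cases k)
    case 0
    then show ?thesis by (simp add: g_def field_simps del: of_nat_Suc)
  next
    case (Suc j)
    define p r e J N where "p = (fact j :: real)" and "r = (fact (j + n) :: real)"
      and "e = (-1 :: real) ^ j" and "J = real j" and "N = real n"
    have pos: "p > 0" "r > 0" "J \<ge> 0" "N \<ge> 0" by (simp_all add: p_def r_def J_def N_def)
    have f: "fact (Suc j) = (J + 1) * p" "fact (Suc j + n) = (J + N + 1) * r"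
      "fact (Suc j + Suc n) = (J + N + 2) * ((J + N + 1) * r)"
      "fact (j + Suc (Suc n)) = (J + N + 2) * ((J + N + 1) * r)"
      by (simp_all add: p_def r_def J_def N_def algebra_simps)
    have nz: "J + 1 \<noteq> 0" "J + N + 1 \<noteq> 0" "J + N + 2 \<noteq> 0" using pos by auto
    have "- e / ((J + 1) * p * ((J + N + 1) * r)) + e / (p * ((J + N + 2) * ((J + N + 1) * r)))
        = (N + 1) * (- e / ((J + 1) * p * ((J + N + 2) * ((J + N + 1) * r))))"
      using pos nz by (simp add: divide_simps) (simp add: algebra_simps)
    then have "?a n (Suc j) + ?a (Suc (Suc n)) j = real (Suc n) * ?a (Suc n) (Suc j)"
      unfolding f p_def[symmetric] by (simp add: e_def N_def add.commute)
    then have "(?a n (Suc j) + ?a (Suc (Suc n)) j) * t ^ Suc j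
        = real (Suc n) * ?a (Suc n) (Suc j) * t ^ Suc j"
      by (rule arg_cong)
    then show ?thesis using Suc by (simp add: g_def algebra_simps)
  qed
  ultimately have "(\<lambda>k. real (Suc n) * (?a (Suc n) k * t ^ k)) sums (bessel_K n t + t * bessel_K (Suc (Suc n)) t)"
    by (simp only:)
  then show ?thesis by (rule sums_unique2[OF _ sums_mult[OF a]])
qed

lemma bessel_J_eq_K: "bessel_J n x = (x / 2) ^ n * bessel_K n (x\<^sup>2 / 4)"
proof -
  have "(\<lambda>k. (x / 2) ^ n * ((-1) ^ k / (fact k * fact (k + n)) * (x\<^sup>2 / 4) ^ k)) =
      (\<lambda>k. (-1) ^ k / (fact k * fact (k + n)) * (x / 2) ^ (2 * k + n))"
  proof
    fix k
    have "(x / 2)\<^sup>2 = x\<^sup>2 / 4" by (simp add: power_divide)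
    then have "(x / 2) ^ (2 * k + n) = (x\<^sup>2 / 4) ^ k * (x / 2) ^ n"
      by (simp only: power_add power_mult)
    then show "(x / 2) ^ n * ((-1) ^ k / (fact k * fact (k + n)) * (x\<^sup>2 / 4) ^ k) =
        (-1) ^ k / (fact k * fact (k + n)) * (x / 2) ^ (2 * k + n)"
      by (simp only: mult_ac)
  qed
  then show ?thesis
    using suminf_mult[OF bessel_K_summable[of n "x\<^sup>2 / 4"], of "(x / 2) ^ n"]
    by (simp add: bessel_J_def bessel_K_def)
qed

text \<open>For t in [0,1] the series alternates with decreasing terms, so Leibniz places its sum
  between the first two partial sums.\<close>

lemma bessel_K_bounds:
  assumes t: "0 \<le> t" "t \<le> 1"
  shows "bessel_K n t \<le> 1 / fact n" "1 / fact n - t / fact (Suc n) \<le> bessel_K n t" "0 \<le> bessel_K n t"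
proof -
  define a where "a = (\<lambda>k. t ^ k / (fact k * fact (k + n)))"
  have K: "bessel_K n t = (\<Sum>k. (-1) ^ k * a k)" by (simp add: bessel_K_def a_def)
  have 0: "0 \<le> a k" for k using t by (simp add: a_def)
  have mono: "a (Suc k) \<le> a k" for k
    unfolding a_def
  proof (rule frac_le)
    show "t ^ Suc k \<le> t ^ k" using t by (intro power_decreasing) auto
    show "(fact k * fact (k + n) :: real) \<le> fact (Suc k) * fact (Suc k + n)"
      by (intro mult_mono fact_mono) auto
  qed (use t in auto)
  have "summable (\<lambda>k. \<bar>t\<bar> ^ k / fact k)" using summable_exp[of "\<bar>t\<bar>"] by (simp add: field_simps)
  then have "(\<lambda>k. \<bar>t\<bar> ^ k / fact k) \<longlonglongrightarrow> 0" by (rule summable_LIMSEQ_zero)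
  then have lim: "a \<longlonglongrightarrow> 0"
  proof (rule Lim_null_comparison[rotated], intro always_eventually allI)
    fix k
    show "norm (a k) \<le> \<bar>t\<bar> ^ k / fact k"
      using t fact_ge_1[of "k + n", where 'a = real]
      by (simp add: a_def field_simps mult_left_mono mult_le_cancel_left1)
  qed
  note L = summable_Leibniz'[OF lim 0 mono]
  show 1: "bessel_K n t \<le> 1 / fact n" using L(4)[of 0] by (simp add: K a_def)
  show 2: "1 / fact n - t / fact (Suc n) \<le> bessel_K n t"
    using L(2)[of 1] by (simp add: K a_def numeral_2_eq_2)
  have "t / fact (Suc n) \<le> 1 / fact n"
    using t by (intro frac_le fact_mono) auto
  with 2 show "0 \<le> bessel_K n t" by linarith
qed

text \<open>The difference quotient of the glued function at \<open>c\<close> is on each side that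
  of one branch. This serves the interface r = b.\<close>

lemma has_real_derivative_If_less:
  fixes f g :: "real \<Rightarrow> real"
  assumes f: "(f has_real_derivative D) (at c)" and g: "(g has_real_derivative D) (at c)"
    and eq: "f c = g c"
  shows "((\<lambda>x. if x < c then f x else g x) has_real_derivative D) (at c)"
proof -
  have "((\<lambda>x. if x < c then (f x - f c) / (x - c) else (g x - g c) / (x - c)) \<longlongrightarrow> D) (at c)"
    using f g unfolding has_field_derivative_iff
    by (intro filterlim_If) (erule filterlim_mono; simp)+
  moreover have "(\<lambda>x. if x < c then (f x - f c) / (x - c) else (g x - g c) / (x - c)) =
      (\<lambda>x. ((if x < c then f x else g x) - (if c < c then f c else g c)) / (x - c))"
    using eq by auto
  ultimately show ?thesis unfolding has_field_derivative_iff by (simp only:)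
qed

lemma has_real_derivative_If_less':
  fixes f g :: "real \<Rightarrow> real"
  assumes f: "x < c \<Longrightarrow> (f has_real_derivative D) (at x)"
    and g: "c < x \<Longrightarrow> (g has_real_derivative D) (at x)" and "x \<noteq> c"
  shows "((\<lambda>x. if x < c then f x else g x) has_real_derivative D) (at x)"
proof (cases "x < c")
  case True
  from f[OF True] show ?thesis
    by (rule has_field_derivative_transform_within_open[where S = "{..<c}"]) (use True in auto)
next
  case False
  then have x: "c < x" using \<open>x \<noteq> c\<close> by simp
  from g[OF x] show ?thesis
    by (rule has_field_derivative_transform_within_open[where S = "{c<..}"]) (use x in auto)
qed

subsection \<open>The radial profile\<close>

locale step_potential =
  fixes b \<gamma> :: real and m :: nat
  assumes b: "0 < b" "b < 1" and \<gamma>: "0 \<le> \<gamma>" "\<gamma> \<le> 1"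
begin

text \<open>The variable x^2/4 of \<open>bessel_K\<close> at the interface, where x = sqrt(\<gamma>)
  b.\<close>

definition "\<tau> = \<gamma> * b\<^sup>2 / 4"

text \<open>The antiderivative of \<open>s\<^bsup>-(m+1)\<^esup>\<close> vanishing at 1.\<close>

definition outer :: "real \<Rightarrow> real" where
  "outer s = (if m = 0 then ln s else (1 - 1 / s ^ m) / real m)"

text \<open>Both constants come from matching at s = b^2. With inner part A K_m(\<gamma>s/4),
  equality of derivatives gives \<open>slope\<close> = - A \<tau> b^(2m) K_{m+1}(\<tau>), and
  equality of values then gives A = 1/\<open>den\<close>. Thus \<open>den\<close> is the value at s
  = 1 of the solution that starts as K_m(\<gamma>s/4).\<close>

definition "den = bessel_K m \<tau> + \<tau> * b ^ (2 * m) * outer (b\<^sup>2) * bessel_K (Suc m) \<tau>"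
definition "slope = - (\<tau> * b ^ (2 * m) * bessel_K (Suc m) \<tau>) / den"

text \<open>The solution of angular frequency \<open>m\<close> is \<open>r\<^bsup>m\<^esup> profile(r\<^sup>2) e\<^bsup>\<plusminus>im\<theta>\<^esup>\<close>, normalised by \<open>profile 1 = 1\<close>.
  The variable \<open>r\<^sup>2\<close> keeps it smooth at the origin, and \<open>slope\<close> makes it \<open>C\<^sup>1\<close> across \<open>r = b\<close>.\<close>

definition profile :: "real \<Rightarrow> real" where
  "profile s = (if s < b\<^sup>2 then bessel_K m (\<gamma> * s / 4) / den else 1 + slope * outer s)"

definition profile' :: "real \<Rightarrow> real" where
  "profile' s = (if s < b\<^sup>2 then - (\<gamma> / 4) * bessel_K (Suc m) (\<gamma> * s / 4) / den else slope / s ^ Suc m)"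

text \<open>The derivative of \<open>profile'\<close> away from s = b^2, where it jumps if \<gamma>
  > 0. At the interface itself the outer formula is used.\<close>

definition profile'' :: "real \<Rightarrow> real" where
  "profile'' s = (if s < b\<^sup>2 then (\<gamma> / 4)\<^sup>2 * bessel_K (Suc (Suc m)) (\<gamma> * s / 4) / den
     else - (real (Suc m) * slope / s ^ Suc (Suc m)))"

lemma \<tau>: "0 \<le> \<tau>" "\<tau> \<le> 1 / 4"
proof -
  have "\<gamma> * b\<^sup>2 \<le> 1 * 1" using b \<gamma> by (intro mult_mono power_le_one) auto
  then show "0 \<le> \<tau>" "\<tau> \<le> 1 / 4" using \<gamma> by (auto simp: \<tau>_def)
qed

lemma b_powers: "0 < b\<^sup>2" "b\<^sup>2 < 1"
  using b by (auto simp: power_less_one_iff)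

lemma outer_zero: "m = 0 \<Longrightarrow> outer s = ln s"
  unfolding outer_def by (rule if_P)

lemma outer_nonzero:
  assumes "m \<noteq> 0"
  shows "b ^ (2 * m) * outer (b\<^sup>2) = (b ^ (2 * m) - 1) / real m"
proof -
  define B where "B = b ^ (2 * m)"
  have "outer (b\<^sup>2) = (1 - 1 / B) / real m"
    unfolding outer_def B_def power_mult using assms by (rule if_not_P)
  moreover have "B \<noteq> 0" using b by (simp add: B_def)
  ultimately show ?thesis unfolding B_def[symmetric] by (simp add: right_diff_distrib)
qed

text \<open>The first summand is at least 1/m! - (1/4)/(m+1)!, and the second at least
  -(1/4)/(m+1)!. Their sum is positive since (m+1)! \<ge> m!.\<close>

lemma den_pos: "0 < den"
proof -
  have "- 1 / 4 \<le> \<tau> * b ^ (2 * m) * outer (b\<^sup>2)"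
  proof (cases "m = 0")
    case True
    \<comment> \<open>The factor b^2 inside \<open>\<tau>\<close> must stay with the logarithm,
      which alone is unbounded below as b tends to 0; ln x \<le> x - 1 at x = 1/b^2 bounds the
      product.\<close>
    have "ln (1 / b\<^sup>2) \<le> 1 / b\<^sup>2 - 1" using b_powers by (intro ln_le_minus_one) auto
    then have "1 - 1 / b\<^sup>2 \<le> ln (b\<^sup>2)" using b_powers b by (simp add: ln_div)
    then have "b\<^sup>2 * (1 - 1 / b\<^sup>2) \<le> b\<^sup>2 * ln (b\<^sup>2)" by (intro mult_left_mono) auto
    then have "b\<^sup>2 - 1 \<le> b\<^sup>2 * ln (b\<^sup>2)" using b by (simp add: right_diff_distrib)
    then have "- 1 \<le> b\<^sup>2 * ln (b\<^sup>2)" using b_powers by linarith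
    then have "\<gamma> * (- 1) \<le> \<gamma> * (b\<^sup>2 * ln (b\<^sup>2))" using \<gamma> by (intro mult_left_mono) auto
    then show ?thesis unfolding outer_zero[OF True] \<tau>_def using True \<gamma> by simp
  next
    case False
    have "0 < b ^ (2 * m)" "b ^ (2 * m) \<le> 1" using b by (auto intro: power_le_one)
    then have "- 1 \<le> b ^ (2 * m) - 1" by simp
    also have "\<dots> \<le> (b ^ (2 * m) - 1) / real m"
    proof -
      have "real m * (b ^ (2 * m) - 1) \<le> 1 * (b ^ (2 * m) - 1)"
        using False \<open>b ^ (2 * m) \<le> 1\<close> by (intro mult_right_mono_neg) auto
      then show ?thesis using False by (simp add: pos_le_divide_eq mult.commute)
    qed
    also have "\<dots> = b ^ (2 * m) * outer (b\<^sup>2)" by (rule outer_nonzero[OF False, symmetric])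
    finally have "\<tau> * (- 1) \<le> \<tau> * (b ^ (2 * m) * outer (b\<^sup>2))"
      using \<tau> by (intro mult_left_mono) auto
    then show ?thesis using \<tau> by (simp add: mult.assoc)
  qed
  then have "(- 1 / 4) * bessel_K (Suc m) \<tau> \<le> (\<tau> * b ^ (2 * m) * outer (b\<^sup>2)) * bessel_K (Suc m) \<tau>"
    using \<tau> by (intro mult_right_mono bessel_K_bounds) auto
  moreover have "bessel_K (Suc m) \<tau> \<le> 1 / fact (Suc m)" "1 / fact m - \<tau> / fact (Suc m) \<le> bessel_K m \<tau>"
    using \<tau> by (auto intro!: bessel_K_bounds simp del: fact_Suc)
  moreover have "\<tau> / fact (Suc m) \<le> (1 / 4) / fact (Suc m)"
    using \<tau> by (intro divide_right_mono) auto
  moreover have "1 / fact (Suc m) \<le> (1 / fact m :: real)"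
    by (intro frac_le fact_mono) auto
  moreover have "0 < (1 / fact m :: real)" by simp
  ultimately show ?thesis unfolding den_def by linarith
qed

lemma outer_deriv: "0 < s \<Longrightarrow> (outer has_real_derivative 1 / s ^ Suc m) (at s)"
proof (cases "m = 0")
  case False
  assume "0 < s"
  then have "((\<lambda>s. (1 - 1 / s ^ m) / real m) has_real_derivative 1 / s ^ Suc m) (at s)"
    using False
    by (auto intro!: derivative_eq_intros simp: field_simps simp flip: power_Suc power_add)
  then show ?thesis using False by (simp add: outer_def[abs_def])
next
  case True
  assume "0 < s"
  then have "(ln has_real_derivative 1 / s ^ Suc m) (at s)"
    by (intro DERIV_cong[OF DERIV_ln]) (simp_all add: True inverse_eq_divide)
  then show ?thesis by (simp only: outer_zero[OF True, abs_def])
qed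

lemma inner_deriv: "((\<lambda>s. bessel_K n (\<gamma> * s / 4)) has_real_derivative
    - (\<gamma> / 4) * bessel_K (Suc n) (\<gamma> * s / 4)) (at s)"
  by (rule DERIV_cong[OF DERIV_chain2[OF bessel_K_deriv]])
     (auto intro!: derivative_eq_intros)

lemma b2_\<tau>: "\<gamma> * b\<^sup>2 / 4 = \<tau>"
  by (simp add: \<tau>_def)

lemma profile_match: "bessel_K m \<tau> / den = 1 + slope * outer (b\<^sup>2)"
  "- (\<gamma> / 4) * bessel_K (Suc m) \<tau> / den = slope / (b\<^sup>2) ^ Suc m"
proof -
  show "bessel_K m \<tau> / den = 1 + slope * outer (b\<^sup>2)"
    using den_pos by (simp add: slope_def field_simps) (simp add: den_def algebra_simps)
  have "slope / (b\<^sup>2) ^ Suc m = - (\<tau> * b ^ (2 * m) * bessel_K (Suc m) \<tau>) / (b\<^sup>2 * (b ^ (2 * m))) / den"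
    unfolding slope_def power_mult power_Suc by simp
  also have "\<dots> = - (\<gamma> / 4) * bessel_K (Suc m) \<tau> / den"
    using b by (simp add: \<tau>_def)
  finally show "- (\<gamma> / 4) * bessel_K (Suc m) \<tau> / den = slope / (b\<^sup>2) ^ Suc m" ..
qed

lemma profile_deriv: "(profile has_real_derivative profile' s) (at s)"
proof (cases "s = b\<^sup>2")
  case True
  have "((\<lambda>s. bessel_K m (\<gamma> * s / 4) / den) has_real_derivative profile' (b\<^sup>2)) (at (b\<^sup>2))"
    by (rule DERIV_cong[OF DERIV_cdivide[OF inner_deriv]])
       (use profile_match(2) in \<open>simp add: profile'_def b2_\<tau>\<close>)
  moreover have "((\<lambda>s. 1 + slope * outer s) has_real_derivative profile' (b\<^sup>2)) (at (b\<^sup>2))"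
    using b_powers by (auto intro!: derivative_eq_intros outer_deriv simp: profile'_def)
  ultimately show ?thesis
    unfolding profile_def[abs_def] True
    by (rule has_real_derivative_If_less) (simp add: b2_\<tau> profile_match)
next
  case False
  show ?thesis
    unfolding profile_def[abs_def]
  proof (rule has_real_derivative_If_less'[OF _ _ False])
    assume "s < b\<^sup>2"
    then show "((\<lambda>s. bessel_K m (\<gamma> * s / 4) / den) has_real_derivative profile' s) (at s)"
      by (intro DERIV_cong[OF DERIV_cdivide[OF inner_deriv]]) (simp add: profile'_def)
  next
    assume "b\<^sup>2 < s"
    moreover from this have "0 < s" using b_powers by linarith
    ultimately show "((\<lambda>s. 1 + slope * outer s) has_real_derivative profile' s) (at s)"
      by (auto intro!: derivative_eq_intros outer_deriv simp: profile'_def)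
  qed
qed

lemma profile'_deriv:
  assumes "s \<noteq> b\<^sup>2"
  shows "(profile' has_real_derivative profile'' s) (at s)"
  unfolding profile'_def[abs_def]
proof (rule has_real_derivative_If_less'[OF _ _ assms])
  assume "s < b\<^sup>2"
  then show "((\<lambda>s. - (\<gamma> / 4) * bessel_K (Suc m) (\<gamma> * s / 4) / den) has_real_derivative profile'' s) (at s)"
    by (intro DERIV_cong[OF DERIV_cdivide[OF DERIV_cmult[OF inner_deriv]]])
       (simp add: profile''_def power2_eq_square)
next
  assume "b\<^sup>2 < s"
  moreover from this have "0 < s" using b_powers by linarith
  ultimately show "((\<lambda>s. slope / s ^ Suc m) has_real_derivative profile'' s) (at s)"
    by (auto intro!: derivative_eq_intros simp: profile''_def field_simps simp del: power_Suc)
       (simp_all add: field_simps)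
qed

lemma profile'_continuous: "isCont profile' s"
proof (cases "s = b\<^sup>2")
  case True
  have "((\<lambda>s. if s < b\<^sup>2 then - (\<gamma> / 4) * bessel_K (Suc m) (\<gamma> * s / 4) / den else slope / s ^ Suc m)
     \<longlongrightarrow> profile' (b\<^sup>2)) (at (b\<^sup>2))"
  proof (intro filterlim_If; rule filterlim_mono[OF _ order_refl inf_le1])
    have "isCont (\<lambda>s. - (\<gamma> / 4) * bessel_K (Suc m) (\<gamma> * s / 4) / den) (b\<^sup>2)"
      by (rule DERIV_isCont[OF DERIV_cdivide[OF DERIV_cmult[OF inner_deriv]]])
    then show "((\<lambda>s. - (\<gamma> / 4) * bessel_K (Suc m) (\<gamma> * s / 4) / den) \<longlongrightarrow> profile' (b\<^sup>2)) (at (b\<^sup>2))"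
      using profile_match(2) by (simp add: isCont_def b2_\<tau> profile'_def)
    have "isCont (\<lambda>s. slope / s ^ Suc m) (b\<^sup>2)" using b by (intro continuous_intros) auto
    then show "((\<lambda>s. slope / s ^ Suc m) \<longlongrightarrow> profile' (b\<^sup>2)) (at (b\<^sup>2))"
      by (simp add: isCont_def profile'_def)
  qed
  then show ?thesis by (simp add: isCont_def True profile'_def[abs_def])
qed (rule DERIV_isCont[OF profile'_deriv])

text \<open>The Laplacian of z^m f(|z|^2) is 4 z^m ((m+1) f' + s f'') with s = |z|^2, so this is the
  radial equation in the variable s. Inside it is the Bessel recurrence; outside f' is a multiple of
  s^-(m+1), which annihilates the left side.\<close>

lemma profile_ode:
  "real (Suc m) * profile' s + s * profile'' s = - ((if s < b\<^sup>2 then \<gamma> else 0) / 4) * profile s"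
proof (cases "s < b\<^sup>2")
  case True
  define t where "t = \<gamma> * s / 4"
  have r: "bessel_K m t = real (Suc m) * bessel_K (Suc m) t - t * bessel_K (Suc (Suc m)) t"
    using bessel_K_rec[of m t] by simp
  show ?thesis using True
    unfolding profile_def profile'_def profile''_def t_def[symmetric] r
    by (simp add: t_def power2_eq_square algebra_simps diff_divide_distrib add_divide_distrib)
next
  case False
  then have "0 < s" using b_powers by linarith
  then show ?thesis using False by (simp add: profile'_def profile''_def)
qed

text \<open>Each branch is continuous on a compact interval; the outer one is taken only on [b^2,1],
  away from its pole at 0.\<close>

lemma profile''_bounded: "\<exists>M. \<forall>s\<in>{0..1}. \<bar>profile'' s\<bar> \<le> M"
proof -
  have "bounded ((\<lambda>s. (\<gamma> / 4)\<^sup>2 * bessel_K (Suc (Suc m)) (\<gamma> * s / 4) / den) ` {0..1})"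
    "bounded ((\<lambda>s. - (real (Suc m) * slope / s ^ Suc (Suc m))) ` {b\<^sup>2..1})"
    using b den_pos
    by (auto intro!: compact_imp_bounded compact_continuous_image continuous_intros
        continuous_on_compose2[OF bessel_K_continuous[of UNIV]] simp del: power_Suc)
  then obtain M N where "\<And>s. s \<in> {0..1} \<Longrightarrow> \<bar>(\<gamma> / 4)\<^sup>2 * bessel_K (Suc (Suc m)) (\<gamma> * s / 4) / den\<bar> \<le> M"
    "\<And>s. s \<in> {b\<^sup>2..1} \<Longrightarrow> \<bar>- (real (Suc m) * slope / s ^ Suc (Suc m))\<bar> \<le> N"
    unfolding bounded_iff real_norm_def by (meson imageI)
  note MN = this
  have "\<bar>profile'' s\<bar> \<le> max M N" if s: "s \<in> {0..1}" for s
  proof (cases "s < b\<^sup>2")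
    case True
    then show ?thesis using MN(1)[OF s] unfolding profile''_def by (simp only: if_True le_max_iff_disj simp_thms)
  next
    case False
    then have "s \<in> {b\<^sup>2..1}" using s by simp
    from MN(2)[OF this] False show ?thesis
      unfolding profile''_def by (simp only: if_False le_max_iff_disj simp_thms)
  qed
  then show ?thesis by blast
qed

lemma profile''_measurable: "profile'' \<in> borel_measurable borel"
proof -
  have "(\<lambda>s. bessel_K (Suc (Suc m)) (\<gamma> * s / 4)) \<in> borel_measurable borel"
    by (intro borel_measurable_continuous_onI continuous_on_compose2[OF bessel_K_continuous[of UNIV]]
        continuous_intros) auto
  then show ?thesis unfolding profile''_def[abs_def] by (intro measurable_If) auto
qed

lemma profile_1: "profile 1 = 1" "profile' 1 = slope"
  using b_powers by (simp_all add: profile_def profile'_def outer_def)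

text \<open>The right side is the derivative of r^m \<open>profile\<close>(r^2) at r = 1. It remains
  to rewrite \<open>slope\<close> by Bessel functions; for \<gamma> = 0 it vanishes because \<tau> =
  0, which gives the convention c_n = |n|.\<close>

lemma dtn_coeff_eq:
  assumes "nat \<bar>n\<bar> = m"
  shows "dtn_coeff b \<gamma> n = real m + 2 * slope"
proof (cases "\<gamma> = 0")
  case True
  then show ?thesis using assms unfolding slope_def \<tau>_def by (simp add: dtn_coeff_def)
next
  case False
  define s where "s = sqrt \<gamma> * b"
  have s: "s\<^sup>2 / 4 = \<tau>" "0 < s" using \<gamma> b False by (simp_all add: s_def \<tau>_def power_mult_distrib)
  have s2: "s * s = 4 * \<tau>" using s(1) by (simp add: power2_eq_square)
  show ?thesis
  proof (cases "m = 0")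
    case True
    then have "n = 0" using assms by auto
    have J1: "s * bessel_J 1 s = 2 * \<tau> * bessel_K 1 \<tau>"
      using s2 by (simp add: bessel_J_eq_K s)
    have "dtn_coeff b \<gamma> n = (- (s * bessel_J 1 s)) / (ln b * (s * bessel_J 1 s) + bessel_J 0 s)"
      using False \<open>n = 0\<close> by (simp add: dtn_coeff_def Let_def s_def mult_ac)
    also have "\<dots> = 2 * slope"
      unfolding J1 slope_def den_def outer_zero[OF True] using True b
      by (simp add: ln_realpow bessel_J_eq_K s algebra_simps)
    finally show ?thesis using True by simp
  next
    case m: False
    define B where "B = b ^ (2 * m)"
    define K0 K1 K2 where "K0 = bessel_K (m - 1) \<tau>" and "K1 = bessel_K m \<tau>"
      and "K2 = bessel_K (Suc m) \<tau>"
    have rec: "K0 + \<tau> * K2 = real m * K1"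
      using bessel_K_rec[of "m - 1" \<tau>] m by (simp add: K0_def K1_def K2_def)
    \<comment> \<open>The recurrence eliminates K_m: the term - \<tau> K_{m+1} coming from
      \<open>outer\<close> cancels against it, leaving the denominator of the stated quotient up to
      a power of s/2.\<close>
    have den: "real m * den = K0 + \<tau> * B * K2"
    proof -
      have "real m * den = real m * K1 + real m * (\<tau> * (B * outer (b\<^sup>2)) * K2)"
        unfolding den_def B_def[symmetric] K1_def[symmetric] K2_def[symmetric] by (simp add: algebra_simps)
      also have "\<dots> = real m * K1 + real m * (\<tau> * ((B - 1) / real m) * K2)"
        unfolding B_def outer_nonzero[OF m] ..
      also have "\<dots> = real m * K1 + \<tau> * (B - 1) * K2" using m by simp
      finally show ?thesis using rec by (simp add: algebra_simps)
    qed
    \<comment> \<open>The common power of s/2 in J_{m-1} and J_{m+1}, which cancels; the two further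
      powers in J_{m+1} make up the factor \<tau>.\<close>
    define w where "w = (s / 2) ^ (m - 1)"
    have "w > 0" using s by (simp add: w_def)
    have J0: "bessel_J (m - 1) s = w * K0" by (simp add: bessel_J_eq_K s w_def K0_def)
    have "(s / 2) ^ (m + 1) = w * (s / 2)\<^sup>2"
      using m by (cases m) (simp_all add: w_def power2_eq_square)
    then have J2: "bessel_J (m + 1) s = w * (\<tau> * K2)"
      using s by (simp add: bessel_J_eq_K K2_def power_divide)
    have "dtn_coeff b \<gamma> n = real m * ((w * K0 - B * (w * (\<tau> * K2))) / (w * K0 + B * (w * (\<tau> * K2))))"
      using False m assms unfolding J0[symmetric] J2[symmetric]
      by (auto simp: dtn_coeff_def Let_def s_def B_def)
    also have "\<dots> = real m * ((w * (K0 - \<tau> * B * K2)) / (w * (K0 + \<tau> * B * K2)))"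
      by (simp add: algebra_simps)
    also have "\<dots> = real m * ((K0 - \<tau> * B * K2) / (real m * den))"
      using \<open>w > 0\<close> unfolding den[symmetric] by simp
    also have "\<dots> = (K0 - \<tau> * B * K2) / den" using m by simp
    also have "K0 - \<tau> * B * K2 = real m * den - 2 * (\<tau> * B * K2)" using den by simp
    also have "(real m * den - 2 * (\<tau> * B * K2)) / den = real m + 2 * slope"
      using den_pos by (simp add: slope_def B_def K2_def diff_divide_distrib)
    finally show ?thesis .
  qed
qed

end

subsection \<open>The separated solution\<close>

definition rsq :: "real \<times> real \<Rightarrow> real" where
  "rsq z = (fst z)\<^sup>2 + (snd z)\<^sup>2"

lemma rsq_norm: "rsq z = (norm z)\<^sup>2"
  by (simp add: rsq_def norm_prod_def)

text \<open>A line parallel to an axis meets a circle at most twice, so r = b is admissible as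
  exceptional set in the divergence theorem.\<close>

lemma finite_sphere_slice: "finite {x. rsq (x, y) = c}" "finite {y. rsq (x, y) = c}"
proof -
  have *: "finite {x::real. x\<^sup>2 = d}" for d
  proof (rule finite_subset)
    show "{x::real. x\<^sup>2 = d} \<subseteq> {sqrt d, - sqrt d}"
      by (auto simp: abs_if split: if_splits)
  qed simp
  have "{x. rsq (x, y) = c} = {x. x\<^sup>2 = c - y\<^sup>2}" "{y. rsq (x, y) = c} = {y. y\<^sup>2 = c - x\<^sup>2}"
    by (auto simp: rsq_def)
  with * show "finite {x. rsq (x, y) = c}" "finite {y. rsq (x, y) = c}" by simp_all
qed

text \<open>The sign \<open>\<sigma>\<close> treats the frequencies m and -m together:
  \<open>zz\<close> is z for \<sigma> = 1 and conj(z) for \<sigma> = -1.\<close>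

locale angular_mode = step_potential +
  fixes \<sigma> :: real
  assumes \<sigma>: "\<sigma>\<^sup>2 = 1"
begin

definition zz :: "real \<times> real \<Rightarrow> complex" where
  "zz z = of_real (fst z) + \<i> * of_real (\<sigma> * snd z)"

definition u :: "real \<times> real \<Rightarrow> complex" where
  "u z = zz z ^ m * of_real (profile (rsq z))"

definition ux :: "real \<times> real \<Rightarrow> complex" where
  "ux z = of_nat m * zz z ^ (m - 1) * of_real (profile (rsq z)) +
     zz z ^ m * of_real (2 * fst z * profile' (rsq z))"

definition uy :: "real \<times> real \<Rightarrow> complex" where
  "uy z = \<i> * of_real \<sigma> * (of_nat m * zz z ^ (m - 1)) * of_real (profile (rsq z)) +
     zz z ^ m * of_real (2 * snd z * profile' (rsq z))"

text \<open>The only discontinuous factor, \<open>profile''\<close>, is isolated in the last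
  summand, so that integrability can be shown separately there. The truncated exponents are
  harmless, as their coefficients vanish with them. The first summand reappears with opposite sign
  in \<open>uyy\<close>, since z^m is harmonic.\<close>

definition uxx :: "real \<times> real \<Rightarrow> complex" where
  "uxx z = of_nat m * (of_nat (m - 1) * zz z ^ (m - 1 - 1)) * of_real (profile (rsq z)) +
     2 * (of_nat m * zz z ^ (m - 1)) * of_real (2 * fst z * profile' (rsq z)) +
     zz z ^ m * of_real (2 * profile' (rsq z)) + profile'' (rsq z) *\<^sub>R (zz z ^ m * of_real (4 * (fst z)\<^sup>2))"

definition uyy :: "real \<times> real \<Rightarrow> complex" where
  "uyy z = - (of_nat m * (of_nat (m - 1) * zz z ^ (m - 1 - 1)) * of_real (profile (rsq z))) +
     2 * (\<i> * of_real \<sigma> * (of_nat m * zz z ^ (m - 1))) * of_real (2 * snd z * profile' (rsq z)) +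
     zz z ^ m * of_real (2 * profile' (rsq z)) + profile'' (rsq z) *\<^sub>R (zz z ^ m * of_real (4 * (snd z)\<^sup>2))"

lemma profile_continuous: "continuous_on UNIV profile" "continuous_on UNIV profile'"
  using DERIV_isCont[OF profile_deriv] profile'_continuous
  by (auto intro: continuous_at_imp_continuous_on)

lemma mode_continuous [continuous_intros]:
  "continuous_on S zz" "continuous_on S rsq"
  "continuous_on S (\<lambda>z. profile (rsq z))" "continuous_on S (\<lambda>z. profile' (rsq z))"
proof -
  show "continuous_on S zz" unfolding zz_def[abs_def] by (intro continuous_intros)
  show r: "continuous_on S rsq" unfolding rsq_def[abs_def] by (intro continuous_intros)
  show "continuous_on S (\<lambda>z. profile (rsq z))" "continuous_on S (\<lambda>z. profile' (rsq z))"
    by (rule continuous_on_compose2[OF profile_continuous(1) r]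
        continuous_on_compose2[OF profile_continuous(2) r]; simp)+
qed

lemma ux_continuous [continuous_intros]:
  "continuous_on S u" "continuous_on S ux" "continuous_on S uy"
  unfolding u_def[abs_def] ux_def[abs_def] uy_def[abs_def]
  by (intro continuous_intros)+

lemma u_has_derivative: "(u has_derivative (\<lambda>h. fst h *\<^sub>R ux z + snd h *\<^sub>R uy z)) (at z within S)"
proof -
  have 1: "(zz has_derivative (\<lambda>h. of_real (fst h) + \<i> * of_real (\<sigma> * snd h))) (at z within S)"
    unfolding zz_def[abs_def] by (auto intro!: derivative_eq_intros)
  have 2: "(rsq has_derivative (\<lambda>h. 2 * fst z * fst h + 2 * snd z * snd h)) (at z within S)"
    unfolding rsq_def[abs_def] by (auto intro!: derivative_eq_intros)
  have "((\<lambda>z. of_real (profile (rsq z)) :: complex) has_derivative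
      (\<lambda>h. of_real ((2 * fst z * fst h + 2 * snd z * snd h) * profile' (rsq z)))) (at z within S)"
    by (intro has_derivative_of_real DERIV_compose_FDERIV[OF profile_deriv 2])
  from has_derivative_mult[OF has_derivative_power[OF 1] this]
  show ?thesis
    unfolding u_def[abs_def]
    by (rule has_derivative_eq_rhs)
       (auto simp: ux_def uy_def scaleR_conv_of_real algebra_simps)
qed

lemma u_C1: "C1_on S u (\<lambda>z. (ux z, uy z))"
  unfolding C1_on_def using u_has_derivative by (auto intro!: continuous_intros)

lemma zz_pow_deriv:
  "((\<lambda>t. zz (t, y) ^ k) has_vector_derivative of_nat k * zz (x, y) ^ (k - 1)) (at x)"
  "((\<lambda>t. zz (x, t) ^ k) has_vector_derivative \<i> * of_real \<sigma> * (of_nat k * zz (x, y) ^ (k - 1))) (at y)"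
proof -
  have 1: "((\<lambda>t. zz (t, y)) has_vector_derivative 1) (at x)"
    "((\<lambda>t. zz (x, t)) has_vector_derivative \<i> * of_real \<sigma>) (at y)"
    unfolding zz_def by (auto intro!: derivative_eq_intros)
  have 2: "((\<lambda>w. w ^ k) has_field_derivative of_nat k * w ^ (k - 1)) (at w)" for w :: complex
    by (auto intro!: derivative_eq_intros)
  from field_vector_diff_chain_at[OF 1(1) 2] field_vector_diff_chain_at[OF 1(2) 2]
  show "((\<lambda>t. zz (t, y) ^ k) has_vector_derivative of_nat k * zz (x, y) ^ (k - 1)) (at x)"
    "((\<lambda>t. zz (x, t) ^ k) has_vector_derivative \<i> * of_real \<sigma> * (of_nat k * zz (x, y) ^ (k - 1))) (at y)"
    by (simp_all add: o_def)
qed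

lemma of_real_rsq_deriv:
  assumes "(f has_real_derivative f') (at (rsq (x, y)))"
  shows "((\<lambda>t. of_real (f (rsq (t, y))) :: complex) has_vector_derivative of_real (2 * x * f')) (at x)"
    and "((\<lambda>t. of_real (f (rsq (x, t))) :: complex) has_vector_derivative of_real (2 * y * f')) (at y)"
proof -
  have "((\<lambda>t. rsq (t, y)) has_real_derivative 2 * x) (at x)"
    "((\<lambda>t. rsq (x, t)) has_real_derivative 2 * y) (at y)"
    unfolding rsq_def by (auto intro!: derivative_eq_intros)
  from DERIV_chain2[OF assms this(1)] DERIV_chain2[OF assms this(2)]
  have "((\<lambda>t. f (rsq (t, y))) has_real_derivative 2 * x * f') (at x)"
    "((\<lambda>t. f (rsq (x, t))) has_real_derivative 2 * y * f') (at y)"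
    by (simp_all add: mult.commute)
  then show "((\<lambda>t. of_real (f (rsq (t, y))) :: complex) has_vector_derivative of_real (2 * x * f')) (at x)"
    "((\<lambda>t. of_real (f (rsq (x, t))) :: complex) has_vector_derivative of_real (2 * y * f')) (at y)"
    by (intro has_vector_derivative_of_real; simp add: has_real_derivative_iff_has_vector_derivative)+
qed

lemma ux_deriv:
  assumes "rsq (x, y) \<noteq> b\<^sup>2"
  shows "((\<lambda>t. ux (t, y)) has_vector_derivative uxx (x, y)) (at x)"
proof -
  have "((\<lambda>t. of_real t :: complex) has_vector_derivative 1) (at x)"
    by (auto intro!: derivative_eq_intros)
  note d = has_vector_derivative_mult[OF this of_real_rsq_deriv(1)[OF profile'_deriv[OF assms]]]
  note a = has_vector_derivative_mult[OF has_vector_derivative_mult[OF has_vector_derivative_const[of "of_nat m"]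
        zz_pow_deriv(1)[where k = "m - 1" and y = y]] of_real_rsq_deriv(1)[where y = y, OF profile_deriv]]
  note c = has_vector_derivative_mult[OF zz_pow_deriv(1)[where k = m and y = y]
      has_vector_derivative_mult[OF has_vector_derivative_const[of 2] d]]
  show ?thesis
    using has_vector_derivative_add[OF a c]
    by (simp add: ux_def uxx_def scaleR_conv_of_real power2_eq_square algebra_simps)
qed

lemma uy_deriv:
  assumes "rsq (x, y) \<noteq> b\<^sup>2"
  shows "((\<lambda>t. uy (x, t)) has_vector_derivative uyy (x, y)) (at y)"
proof -
  have s: "of_real \<sigma> * (of_real \<sigma> * w) = (w::complex)" for w
    using \<sigma> by (simp add: power2_eq_square flip: mult.assoc of_real_mult)
  have i: "\<i> * (\<i> * w) = - w" for w by (simp flip: mult.assoc)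
  have "((\<lambda>t. of_real t :: complex) has_vector_derivative 1) (at y)"
    by (auto intro!: derivative_eq_intros)
  note d = has_vector_derivative_mult[OF this of_real_rsq_deriv(2)[OF profile'_deriv[OF assms]]]
  note a = has_vector_derivative_mult[OF has_vector_derivative_mult[OF
        has_vector_derivative_const[of "\<i> * of_real \<sigma> * of_nat m"]
        zz_pow_deriv(2)[where k = "m - 1" and x = x]] of_real_rsq_deriv(2)[where x = x, OF profile_deriv]]
  note c = has_vector_derivative_mult[OF zz_pow_deriv(2)[where k = m and x = x]
      has_vector_derivative_mult[OF has_vector_derivative_const[of 2] d]]
  show ?thesis
    using has_vector_derivative_add[OF a c]
    by (simp add: uy_def uyy_def scaleR_conv_of_real power2_eq_square algebra_simps s i)
qed

definition q :: "real \<times> real \<Rightarrow> real" where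
  "q z = \<gamma> * indicator {0<..<b} (norm z)"

text \<open>The cross terms combine by m z^(m-1) (x + i \<sigma> y) = m z^m, and the radial equation
  does the rest. The origin is excluded because the open interval in \<open>q\<close> makes the
  potential 0 there.\<close>

lemma laplace_u:
  assumes "z \<noteq> 0"
  shows "uxx z + uyy z = - (of_real (q z) * u z)"
proof -
  have q: "q z = (if rsq z < b\<^sup>2 then \<gamma> else 0)"
    using assms b by (auto simp: q_def rsq_norm indicator_def abs_less_iff
        dest: power_less_imp_less_base intro: power_strict_mono)
  have Z: "of_nat m * zz z ^ (m - 1) * zz z = of_nat m * zz z ^ m"
    by (cases m) simp_all
  have e: "real (Suc m) * profile' (rsq z) + rsq z * profile'' (rsq z) = - (q z / 4) * profile (rsq z)"
    unfolding q by (rule profile_ode)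
  have "uxx z + uyy z = 4 * (of_nat m * zz z ^ (m - 1) * zz z) * of_real (profile' (rsq z)) +
      zz z ^ m * of_real (4 * profile' (rsq z) + 4 * rsq z * profile'' (rsq z))"
    by (simp add: uxx_def uyy_def zz_def[of z] rsq_def scaleR_conv_of_real algebra_simps)
  also have "\<dots> = zz z ^ m * of_real (4 * (real (Suc m) * profile' (rsq z) + rsq z * profile'' (rsq z)))"
    unfolding Z by (simp add: algebra_simps)
  also have "\<dots> = - (of_real (q z) * u z)"
    unfolding e by (simp add: u_def)
  finally show ?thesis .
qed

end

subsection \<open>Weak solutions\<close>

context angular_mode
begin

lemma profile''_integrable:
  fixes f :: "real \<times> real \<Rightarrow> complex"
  assumes "continuous_on (cball 0 1) f"
  shows "set_integrable lborel disc (\<lambda>z. profile'' (rsq z) *\<^sub>R f z)"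
proof -
  obtain M where M: "\<And>s. s \<in> {0..1} \<Longrightarrow> \<bar>profile'' s\<bar> \<le> M"
    using profile''_bounded by blast
  have "L2_on disc (\<lambda>z. profile'' (rsq z) *\<^sub>R (1 :: real))"
  proof (rule L2_on_bounded_mult)
    show "L2_on disc (\<lambda>z. 1 :: real)"
      by (rule continuous_on_imp_L2_on[of "cball 0 1"]) auto
    have "rsq \<in> borel_measurable borel"
      by (intro borel_measurable_continuous_onI mode_continuous)
    then have "(\<lambda>z. profile'' (rsq z)) \<in> borel_measurable borel"
      by (rule measurable_compose[OF _ profile''_measurable])
    then show "(\<lambda>z. profile'' (rsq z)) \<in> borel_measurable lborel" by simp
    fix z :: "real \<times> real" assume "z \<in> disc"
    then have "rsq z \<in> {0..1}" by (simp add: rsq_norm power_le_one)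
    then show "\<bar>profile'' (rsq z)\<bar> \<le> M" by (rule M)
  qed
  moreover have "L2_on disc f"
    by (rule continuous_on_imp_L2_on[of "cball 0 1", OF _ assms]) auto
  ultimately show ?thesis
    using L2_on_bilinear_integrable[OF bounded_bilinear_scaleR] by fastforce
qed

text \<open>The divergence theorem for the field conj(\<phi>) \<nabla>u, whose divergence is the
  integrand on the left apart from the origin and the circle r = b. That circle is the exceptional
  set.\<close>

lemma green_identity:
  assumes \<phi>: "C1_on (cball 0 1) \<phi> D\<phi>"
  shows "(LINT z:disc|lborel. ux z * cnj (fst (D\<phi> z)) + uy z * cnj (snd (D\<phi> z))
      - of_real (q z) * u z * cnj (\<phi> z)) =
    (LINT t:{0..2*pi}|lborel. (cos t *\<^sub>R ux (cos t, sin t) + sin t *\<^sub>R uy (cos t, sin t)) *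
      cnj (\<phi> (cos t, sin t)))" (is "_ = ?R")
proof -
  have c [continuous_intros]: "continuous_on (cball 0 1) \<phi>" "continuous_on (cball 0 1) D\<phi>"
    using \<phi> C1_on_continuous by (auto simp: C1_on_def)
  define p where "p = (\<lambda>z. uxx z * cnj (\<phi> z) + ux z * cnj (fst (D\<phi> z)))"
  define r where "r = (\<lambda>z. uyy z * cnj (\<phi> z) + uy z * cnj (snd (D\<phi> z)))"
  have i: "set_integrable lborel disc p" "set_integrable lborel disc r"
  proof -
    have "set_integrable lborel disc (\<lambda>z.
      ((of_nat m * (of_nat (m - 1) * zz z ^ (m - 1 - 1)) * of_real (profile (rsq z)) +
       2 * (of_nat m * zz z ^ (m - 1)) * of_real (2 * fst z * profile' (rsq z)) +
       zz z ^ m * of_real (2 * profile' (rsq z))) * cnj (\<phi> z) + ux z * cnj (fst (D\<phi> z))) +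
      profile'' (rsq z) *\<^sub>R (zz z ^ m * of_real (4 * (fst z)\<^sup>2) * cnj (\<phi> z)))"
      by (intro set_integral_add(1)[OF set_integrable_disc profile''_integrable] continuous_intros)
    then show "set_integrable lborel disc p"
      by (simp add: p_def uxx_def algebra_simps)
    have "set_integrable lborel disc (\<lambda>z.
      ((- (of_nat m * (of_nat (m - 1) * zz z ^ (m - 1 - 1)) * of_real (profile (rsq z))) +
       2 * (\<i> * of_real \<sigma> * (of_nat m * zz z ^ (m - 1))) * of_real (2 * snd z * profile' (rsq z)) +
       zz z ^ m * of_real (2 * profile' (rsq z))) * cnj (\<phi> z) + uy z * cnj (snd (D\<phi> z))) +
      profile'' (rsq z) *\<^sub>R (zz z ^ m * of_real (4 * (snd z)\<^sup>2) * cnj (\<phi> z)))"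
      by (intro set_integral_add(1)[OF set_integrable_disc profile''_integrable] continuous_intros)
    then show "set_integrable lborel disc r"
      by (simp add: r_def uyy_def algebra_simps)
  qed
  have "(LINT z:disc|lborel. ux z * cnj (fst (D\<phi> z)) + uy z * cnj (snd (D\<phi> z))
      - of_real (q z) * u z * cnj (\<phi> z)) =
    (LINT z:disc - {0}|lborel. ux z * cnj (fst (D\<phi> z)) + uy z * cnj (snd (D\<phi> z))
      - of_real (q z) * u z * cnj (\<phi> z))"
    \<comment> \<open>The equation for \<open>u\<close> is available off the origin only; a single
      point may be removed and put back.\<close>
    by (rule set_integral_discrete_difference[where X = "{0}"]) auto
  also have "\<dots> = (LINT z:disc - {0}|lborel. p z + r z)"
  proof (rule set_lebesgue_integral_cong)
    have "p z + r z = ux z * cnj (fst (D\<phi> z)) + uy z * cnj (snd (D\<phi> z)) + (uxx z + uyy z) * cnj (\<phi> z)" for z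
      by (simp add: p_def r_def algebra_simps)
    then show "\<forall>z. z \<in> disc - {0} \<longrightarrow> ux z * cnj (fst (D\<phi> z)) + uy z * cnj (snd (D\<phi> z))
      - of_real (q z) * u z * cnj (\<phi> z) = p z + r z"
      using laplace_u by simp
  qed auto
  also have "\<dots> = (LINT z:disc|lborel. p z + r z)"
    by (rule set_integral_discrete_difference[where X = "{0}"]) auto
  also have "\<dots> = (LINT t:{0..2*pi}|lborel. cos t *\<^sub>R (ux (cos t, sin t) * cnj (\<phi> (cos t, sin t))) +
      sin t *\<^sub>R (uy (cos t, sin t) * cnj (\<phi> (cos t, sin t))))"
  proof (rule disc_divergence[where N = "{z. rsq z = b\<^sup>2}" and P = "\<lambda>z. ux z * cnj (\<phi> z)"
        and Q = "\<lambda>z. uy z * cnj (\<phi> z)", OF _ _ i])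
    show "continuous_on (cball 0 1) (\<lambda>z. ux z * cnj (\<phi> z))"
      "continuous_on (cball 0 1) (\<lambda>z. uy z * cnj (\<phi> z))"
      by (intro continuous_intros)+
    show "finite {x. (x, y) \<in> {z. rsq z = b\<^sup>2}}" for y using finite_sphere_slice(1) by simp
    show "finite {y. (x, y) \<in> {z. rsq z = b\<^sup>2}}" for x using finite_sphere_slice(2) by simp
    fix x y :: real assume xy: "(x, y) \<in> disc" "(x, y) \<notin> {z. rsq z = b\<^sup>2}"
    then have "(x, y) \<in> interior (cball 0 1)" by simp
    note d = C1_on_partials[OF \<phi> this]
    from xy have "rsq (x, y) \<noteq> b\<^sup>2" by simp
    note e = ux_deriv[OF this] uy_deriv[OF this]
    show "((\<lambda>t. ux (t, y) * cnj (\<phi> (t, y))) has_vector_derivative p (x, y)) (at x)"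
      using has_vector_derivative_mult[OF e(1) has_vector_derivative_cnj[OF d(1)]]
      by (simp add: p_def add.commute)
    show "((\<lambda>t. uy (x, t) * cnj (\<phi> (x, t))) has_vector_derivative r (x, y)) (at y)"
      using has_vector_derivative_mult[OF e(2) has_vector_derivative_cnj[OF d(2)]]
      by (simp add: r_def add.commute)
  qed
  also have "\<dots> = ?R"
    by (simp add: distrib_right)
  finally show ?thesis .
qed

lemma q_measurable: "q \<in> borel_measurable lborel"
  unfolding q_def[abs_def] by measurable

lemma q_bounded: "0 \<le> q z" "q z \<le> 1"
  using \<gamma> by (auto simp: q_def indicator_def)

end

section \<open>Hermitian pairings and limits of C1 functions\<close>

lemma bounded_bilinear_mult_cnj: "bounded_bilinear (\<lambda>a b. a * cnj b)"
  by (rule bounded_bilinear.comp[OF bounded_bilinear_mult bounded_linear_ident bounded_linear_cnj])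

text \<open>The Hermitian product on pairs of complex numbers. Being bilinear over the reals, it
  falls under the general L2 integrability and limit lemmas.\<close>

definition grad_prod :: "complex \<times> complex \<Rightarrow> complex \<times> complex \<Rightarrow> complex" where
  "grad_prod a b = fst a * cnj (fst b) + snd a * cnj (snd b)"

lemma bounded_bilinear_grad_prod: "bounded_bilinear grad_prod"
proof
  show "\<exists>K. \<forall>a b. norm (grad_prod a b) \<le> norm a * norm b * K"
  proof (intro exI[of _ 2] allI)
    fix a b :: "complex \<times> complex"
    have "norm (grad_prod a b) \<le> norm (fst a) * norm (fst b) + norm (snd a) * norm (snd b)"
      unfolding grad_prod_def by (rule norm_triangle_le) (simp add: norm_mult)
    also have "\<dots> \<le> norm a * norm b + norm a * norm b"
      using norm_fst_le[where x = "fst a" and y = "snd a"] norm_fst_le[where x = "fst b" and y = "snd b"]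
        norm_snd_le[where x = "fst a" and y = "snd a"] norm_snd_le[where x = "fst b" and y = "snd b"]
      by (intro add_mono mult_mono) auto
    finally show "norm (grad_prod a b) \<le> norm a * norm b * 2" by simp
  qed
qed (simp_all add: grad_prod_def algebra_simps scaleR_conv_of_real)

lemma grad_prod_self: "grad_prod a a = of_real ((norm a)\<^sup>2)"
proof -
  have "w * cnj w = of_real ((norm w)\<^sup>2)" for w :: complex
    by (simp only: complex_norm_square)
  then show ?thesis by (simp add: grad_prod_def norm_prod_def)
qed

lemma norm_weight_L2_on: "L2_on disc f \<Longrightarrow> L2_on disc (\<lambda>z. norm z *\<^sub>R f z)"
  for f :: "real \<times> real \<Rightarrow> 'a::euclidean_space"
  by (rule L2_on_bounded_mult[where M = 1]) auto

lemma C1_on_L2: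
  assumes "C1_on (cball 0 1) f Df"
  shows "L2_on disc f" "L2_on disc Df" "L2_on {0..2*pi} (\<lambda>t. f (cos t, sin t))"
proof -
  have c: "continuous_on (cball 0 1) f" "continuous_on (cball 0 1) Df"
    using assms C1_on_continuous by (auto simp: C1_on_def)
  show "L2_on disc f" "L2_on disc Df"
    by (rule continuous_on_imp_L2_on[of "cball 0 1", OF _ c(1)]
        continuous_on_imp_L2_on[of "cball 0 1", OF _ c(2)]; auto)+
  have "continuous_on {0..2*pi} (\<lambda>t. f (cos t, sin t))"
    by (intro continuous_on_compose2[OF c(1)] continuous_intros) (auto simp: norm_Pair)
  then show "L2_on {0..2*pi} (\<lambda>t. f (cos t, sin t))"
    by (intro continuous_on_imp_L2_on[of "{0..2*pi}"]) auto
qed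

lemma set_integral_zero_fun: "(LINT x:S|M. 0) = 0"
  by (simp add: set_lebesgue_integral_def)

lemma H1_trace_C1:
  assumes u: "C1_on (cball 0 1) u Du" and "L2_on {0..2*pi} g"
    and g: "\<And>t. g t = u (cos t, sin t)"
  shows "H1_trace u Du g"
  unfolding H1_trace_def
  using C1_on_L2[OF u] assms
  by (intro conjI exI[of _ "\<lambda>_. u"] exI[of _ "\<lambda>_. Du"]) (auto simp: set_integral_zero_fun)

text \<open>Subtracting \<open>u\<close> from each approximating function suffices, since
  \<open>u\<close> is itself C1 up to the boundary.\<close>

lemma H1_trace_diff_C1:
  assumes v: "H1_trace v Dv g" and u: "C1_on (cball 0 1) u Du"
    and g: "\<And>t. g t = u (cos t, sin t)"
  shows "H1_trace (\<lambda>x. v x - u x) (\<lambda>x. Dv x - Du x) (\<lambda>_. 0)"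
proof -
  obtain \<phi> D\<phi> where \<phi>: "\<And>k::nat. C1_on (cball 0 1) (\<phi> k) (D\<phi> k)"
    "(\<lambda>k. LINT x:disc|lborel. (norm (\<phi> k x - v x))\<^sup>2) \<longlonglongrightarrow> 0"
    "(\<lambda>k. LINT x:disc|lborel. (norm (D\<phi> k x - Dv x))\<^sup>2) \<longlonglongrightarrow> 0"
    "(\<lambda>k. LINT t:{0..2*pi}|lborel. (norm (\<phi> k (cos t, sin t) - g t))\<^sup>2) \<longlonglongrightarrow> 0"
    using v unfolding H1_trace_def by blast
  have "L2_on disc (\<lambda>x. v x - u x)" "L2_on disc (\<lambda>x. Dv x - Du x)"
    using v C1_on_L2[OF u] by (auto simp: H1_trace_def intro!: L2_on_diff)
  moreover have "L2_on {0..2*pi} (\<lambda>_. 0 :: complex)"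
    by (rule continuous_on_imp_L2_on[of "{0..2*pi}"]) auto
  moreover have "\<forall>k. C1_on (cball 0 1) (\<lambda>x. \<phi> k x - u x) (\<lambda>x. D\<phi> k x - Du x)"
    using C1_on_diff[OF \<phi>(1) u] by blast
  ultimately show ?thesis
    unfolding H1_trace_def using \<phi>(2-4)
    by (intro conjI exI[of _ "\<lambda>k x. \<phi> k x - u x"] exI[of _ "\<lambda>k x. D\<phi> k x - Du x"]) (simp_all add: g)
qed

text \<open>The C1 inequality passes to the limit along the approximating sequence, and its boundary
  term tends to 0. The weight |z| \<le> 1 preserves L2 convergence of the gradients.\<close>

lemma H1_trace_zero_poincare:
  assumes "H1_trace w Dw (\<lambda>_. 0)"
  shows "(LINT z:disc|lborel. (norm (w z))\<^sup>2) \<le> (LINT z:disc|lborel. (norm (norm z *\<^sub>R Dw z))\<^sup>2)"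
proof -
  obtain \<phi> D\<phi> where \<phi>: "\<And>k::nat. C1_on (cball 0 1) (\<phi> k) (D\<phi> k)"
    "(\<lambda>k. LINT x:disc|lborel. (norm (\<phi> k x - w x))\<^sup>2) \<longlonglongrightarrow> 0"
    "(\<lambda>k. LINT x:disc|lborel. (norm (D\<phi> k x - Dw x))\<^sup>2) \<longlonglongrightarrow> 0"
    "(\<lambda>k. LINT t:{0..2*pi}|lborel. (norm (\<phi> k (cos t, sin t) - 0))\<^sup>2) \<longlonglongrightarrow> 0"
    using assms unfolding H1_trace_def by blast
  have w: "L2_on disc w" "L2_on disc Dw" using assms by (auto simp: H1_trace_def)
  note l = C1_on_L2[OF \<phi>(1)]
  have "(\<lambda>k. LINT z:disc|lborel. (norm (norm z *\<^sub>R D\<phi> k z - norm z *\<^sub>R Dw z))\<^sup>2) \<longlonglongrightarrow> 0"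
  proof (rule tendsto_sandwich[OF _ _ tendsto_const \<phi>(3)]; intro always_eventually allI)
    fix k
    show "0 \<le> (LINT z:disc|lborel. (norm (norm z *\<^sub>R D\<phi> k z - norm z *\<^sub>R Dw z))\<^sup>2)"
      by (rule set_integral_nonneg') simp
    show "(LINT z:disc|lborel. (norm (norm z *\<^sub>R D\<phi> k z - norm z *\<^sub>R Dw z))\<^sup>2) \<le>
        (LINT z:disc|lborel. (norm (D\<phi> k z - Dw z))\<^sup>2)"
    proof (rule set_integral_mono)
      show "set_integrable lborel disc (\<lambda>z. (norm (norm z *\<^sub>R D\<phi> k z - norm z *\<^sub>R Dw z))\<^sup>2)"
        "set_integrable lborel disc (\<lambda>z. (norm (D\<phi> k z - Dw z))\<^sup>2)"
        by (rule L2_on_norm_sq L2_on_diff norm_weight_L2_on l w)+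
      fix z :: "real \<times> real" assume "z \<in> disc"
      then have "norm z * norm (D\<phi> k z - Dw z) \<le> norm (D\<phi> k z - Dw z)"
        by (intro mult_left_le_one_le) auto
      then show "(norm (norm z *\<^sub>R D\<phi> k z - norm z *\<^sub>R Dw z))\<^sup>2 \<le> (norm (D\<phi> k z - Dw z))\<^sup>2"
        unfolding scaleR_diff_right[symmetric] by (intro power_mono) simp_all
    qed
  qed
  note n = L2_on_norm_limit[OF norm_weight_L2_on[OF l(2)] norm_weight_L2_on[OF w(2)] this]
  have "(LINT z:disc|lborel. (norm (w z))\<^sup>2) \<le> 0 + (LINT z:disc|lborel. (norm (norm z *\<^sub>R Dw z))\<^sup>2)"
  proof (rule LIMSEQ_le[OF L2_on_norm_limit[OF l(1) w(1) \<phi>(2)] tendsto_add[OF \<phi>(4) n]])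
    show "\<exists>N. \<forall>k\<ge>N. (LINT z:disc|lborel. (norm (\<phi> k z))\<^sup>2) \<le>
      (LINT t:{0..2*pi}|lborel. (norm (\<phi> k (cos t, sin t) - 0))\<^sup>2) +
      (LINT z:disc|lborel. (norm (norm z *\<^sub>R D\<phi> k z))\<^sup>2)"
      using disc_poincare[OF \<phi>(1)] by simp
  qed
  then show ?thesis by simp
qed

context angular_mode
begin

definition weak_form :: "(real \<times> real \<Rightarrow> complex) \<Rightarrow> (real \<times> real \<Rightarrow> complex \<times> complex) \<Rightarrow>
    (real \<times> real \<Rightarrow> complex) \<Rightarrow> (real \<times> real \<Rightarrow> complex \<times> complex) \<Rightarrow> complex" where
  "weak_form v Dv w Dw = (LINT x:disc|lborel. fst (Dv x) * cnj (fst (Dw x)) + snd (Dv x) * cnj (snd (Dw x))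
     - of_real (q x) * v x * cnj (w x))"

lemma weak_form_eq:
  assumes "L2_on disc v" "L2_on disc Dv" "L2_on disc w" "L2_on disc Dw"
  shows "weak_form v Dv w Dw =
    (LINT x:disc|lborel. grad_prod (Dv x) (Dw x)) - (LINT x:disc|lborel. (q x *\<^sub>R v x) * cnj (w x))"
proof -
  have "L2_on disc (\<lambda>x. q x *\<^sub>R v x)"
    using q_bounded by (intro L2_on_bounded_mult[where M = 1] assms q_measurable) (simp add: abs_le_iff)
  from set_integral_diff(2)[OF L2_on_bilinear_integrable[OF bounded_bilinear_grad_prod assms(2,4)]
      L2_on_bilinear_integrable[OF bounded_bilinear_mult_cnj this assms(3)]]
  show ?thesis unfolding weak_form_def grad_prod_def scaleR_conv_of_real .
qed

text \<open>Green's identity holds for each C1 approximant of \<open>w\<close>. Its boundary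
  integrals tend to 0 because the approximants tend to 0 in L2 of the circle.\<close>

lemma weak_form_u:
  assumes "H1_trace w Dw (\<lambda>_. 0)"
  shows "weak_form u (\<lambda>z. (ux z, uy z)) w Dw = 0"
proof -
  obtain \<phi> D\<phi> where \<phi>: "\<And>k::nat. C1_on (cball 0 1) (\<phi> k) (D\<phi> k)"
    "(\<lambda>k. LINT x:disc|lborel. (norm (\<phi> k x - w x))\<^sup>2) \<longlonglongrightarrow> 0"
    "(\<lambda>k. LINT x:disc|lborel. (norm (D\<phi> k x - Dw x))\<^sup>2) \<longlonglongrightarrow> 0"
    "(\<lambda>k. LINT t:{0..2*pi}|lborel. (norm (\<phi> k (cos t, sin t) - 0))\<^sup>2) \<longlonglongrightarrow> 0"
    using assms unfolding H1_trace_def by blast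
  have w: "L2_on disc w" "L2_on disc Dw" "L2_on {0..2*pi} (\<lambda>_. 0 :: complex)"
    using assms by (auto simp: H1_trace_def)
  note l = C1_on_L2[OF \<phi>(1)]
  let ?Du = "\<lambda>z. (ux z, uy z)"
  note lu = C1_on_L2[OF u_C1]
  have qu: "L2_on disc (\<lambda>x. q x *\<^sub>R u x)"
    using q_bounded by (intro L2_on_bounded_mult[where M = 1] lu q_measurable) (simp add: abs_le_iff)
  let ?B = "\<lambda>t. cos t *\<^sub>R ux (cos t, sin t) + sin t *\<^sub>R uy (cos t, sin t)"
  have "continuous_on {0..2*pi} ?B"
    by (intro continuous_intros continuous_on_compose2[OF ux_continuous(2)[of UNIV]]
        continuous_on_compose2[OF ux_continuous(3)[of UNIV]]) auto
  then have B: "L2_on {0..2*pi} ?B"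
    by (intro continuous_on_imp_L2_on[of "{0..2*pi}"]) auto
  have "(\<lambda>k. weak_form u ?Du (\<phi> k) (D\<phi> k)) \<longlonglongrightarrow> weak_form u ?Du w Dw"
    unfolding weak_form_eq[OF lu(1,2) l(1,2)] weak_form_eq[OF lu(1,2) w(1,2)]
    \<comment> \<open>Here the second argument varies, whereas the limit lemma varies the first;
      hence the flipped pairings.\<close>
    by (intro tendsto_diff
        L2_on_bilinear_limit[OF bounded_bilinear.flip[OF bounded_bilinear_grad_prod] l(2) w(2) lu(2) \<phi>(3)]
        L2_on_bilinear_limit[OF bounded_bilinear.flip[OF bounded_bilinear_mult_cnj] l(1) w(1) qu \<phi>(2)])
  moreover have "(\<lambda>k. LINT t:{0..2*pi}|lborel. ?B t * cnj (\<phi> k (cos t, sin t))) \<longlonglongrightarrow>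
      (LINT t:{0..2*pi}|lborel. ?B t * cnj 0)"
    by (rule L2_on_bilinear_limit[OF bounded_bilinear.flip[OF bounded_bilinear_mult_cnj] l(3) w(3) B \<phi>(4)])
  moreover have "weak_form u ?Du (\<phi> k) (D\<phi> k) = (LINT t:{0..2*pi}|lborel. ?B t * cnj (\<phi> k (cos t, sin t)))" for k
    unfolding weak_form_def fst_conv snd_conv by (rule green_identity[OF \<phi>(1)])
  ultimately show ?thesis
    using LIMSEQ_unique by (fastforce simp: set_integral_zero_fun)
qed

text \<open>The difference \<open>d\<close> of two solutions has \<open>\<integral>|\<nabla>d|\<^sup>2 = \<integral>q|d|\<^sup>2 \<le> \<integral>|d|\<^sup>2 \<le> \<integral>|x|\<^sup>2|\<nabla>d|\<^sup>2\<close>,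
  and \<open>|x| < 1\<close> in the disc.\<close>

lemma weak_solution_unique:
  assumes v: "weak_solution q g v" and g: "\<And>t. g t = u (cos t, sin t)"
  shows "AE x in lborel. x \<in> disc \<longrightarrow> v x = u x"
proof -
  let ?Du = "\<lambda>z. (ux z, uy z)"
  obtain Dv where Dv: "H1_trace v Dv g" "\<And>w Dw. H1_trace w Dw (\<lambda>_. 0) \<Longrightarrow> weak_form v Dv w Dw = 0"
    using v unfolding weak_solution_def weak_form_def by blast
  define d Dd where "d = (\<lambda>x. v x - u x)" and "Dd = (\<lambda>x. Dv x - ?Du x)"
  have tr: "H1_trace d Dd (\<lambda>_. 0)"
    unfolding d_def Dd_def by (rule H1_trace_diff_C1[OF Dv(1) u_C1 g])
  have l: "L2_on disc d" "L2_on disc Dd" "L2_on disc v" "L2_on disc Dv"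
    using tr Dv(1) by (auto simp: H1_trace_def)
  note lu = C1_on_L2[OF u_C1]
  have ql: "L2_on disc f \<Longrightarrow> L2_on disc (\<lambda>x. q x *\<^sub>R f x)" for f :: "real \<times> real \<Rightarrow> complex"
    using q_bounded by (intro L2_on_bounded_mult[where M = 1] q_measurable) (simp_all add: abs_le_iff)
  note ig = L2_on_bilinear_integrable[OF bounded_bilinear_grad_prod]
  note iq = L2_on_bilinear_integrable[OF bounded_bilinear_mult_cnj ql]
  have "weak_form d Dd d Dd = weak_form v Dv d Dd - weak_form u ?Du d Dd"
  proof -
    have "(LINT x:disc|lborel. grad_prod (Dd x) (Dd x)) =
      (LINT x:disc|lborel. grad_prod (Dv x) (Dd x)) - (LINT x:disc|lborel. grad_prod (?Du x) (Dd x))"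
      by (subst set_integral_diff(2)[OF ig[OF l(4,2)] ig[OF lu(2) l(2)], symmetric])
         (simp add: Dd_def bounded_bilinear.diff_left[OF bounded_bilinear_grad_prod])
    moreover have "(LINT x:disc|lborel. (q x *\<^sub>R d x) * cnj (d x)) =
      (LINT x:disc|lborel. (q x *\<^sub>R v x) * cnj (d x)) - (LINT x:disc|lborel. (q x *\<^sub>R u x) * cnj (d x))"
      by (subst set_integral_diff(2)[OF iq[OF l(3,1)] iq[OF lu(1) l(1)], symmetric])
         (simp add: d_def scaleR_diff_right left_diff_distrib)
    ultimately show ?thesis
      unfolding weak_form_eq[OF l(1,2,1,2)] weak_form_eq[OF l(3,4,1,2)] weak_form_eq[OF lu(1,2) l(1,2)]
      by simp
  qed
  also have "\<dots> = 0" using Dv(2)[OF tr] weak_form_u[OF tr] by simp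
  finally have "(LINT x:disc|lborel. grad_prod (Dd x) (Dd x)) = (LINT x:disc|lborel. (q x *\<^sub>R d x) * cnj (d x))"
    unfolding weak_form_eq[OF l(1,2,1,2)] by simp
  moreover have "(q x *\<^sub>R d x) * cnj (d x) = of_real (q x * (norm (d x))\<^sup>2)" for x
    by (simp add: scaleR_conv_of_real flip: complex_norm_square)
  ultimately have "complex_of_real (LINT x:disc|lborel. (norm (Dd x))\<^sup>2) = of_real (LINT x:disc|lborel. q x * (norm (d x))\<^sup>2)"
    unfolding grad_prod_self by (simp only: set_integral_complex_of_real)
  then have 1: "(LINT x:disc|lborel. (norm (Dd x))\<^sup>2) = (LINT x:disc|lborel. q x * (norm (d x))\<^sup>2)"
    by (simp only: of_real_eq_iff)
  have "set_integrable lborel disc (\<lambda>x. q x * (norm (d x))\<^sup>2)"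
    using L2_on_bilinear_integrable[OF bounded_bilinear_inner ql[OF l(1)] l(1)]
    by (simp add: power2_norm_eq_inner)
  then have 2: "(LINT x:disc|lborel. q x * (norm (d x))\<^sup>2) \<le> (LINT x:disc|lborel. (norm (d x))\<^sup>2)"
    by (rule set_integral_mono[OF _ L2_on_norm_sq[OF l(1)]])
       (use q_bounded in \<open>simp add: mult_left_le_one_le\<close>)
  note 3 = H1_trace_zero_poincare[OF tr]
  \<comment> \<open>The square of this weight is the gap between \<integral>|\<nabla>d|^2 and
    \<integral>|x|^2|\<nabla>d|^2. It is positive inside the disc, so a vanishing gap forces the
    gradient to vanish almost everywhere.\<close>
  let ?s = "\<lambda>z::real \<times> real. sqrt (1 - (norm z)\<^sup>2)"
  have ls: "L2_on disc (\<lambda>z. ?s z *\<^sub>R Dd z)"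
  proof (rule L2_on_bounded_mult[where M = 1, OF l(2)])
    fix z :: "real \<times> real" assume "z \<in> disc"
    then show "\<bar>?s z\<bar> \<le> 1" by (simp add: power_le_one)
  qed measurable
  have "(LINT z:disc|lborel. (norm (?s z *\<^sub>R Dd z))\<^sup>2) =
      (LINT z:disc|lborel. (norm (Dd z))\<^sup>2 - (norm (norm z *\<^sub>R Dd z))\<^sup>2)"
  proof (rule set_lebesgue_integral_cong)
    show "\<forall>z. z \<in> disc \<longrightarrow> (norm (?s z *\<^sub>R Dd z))\<^sup>2 = (norm (Dd z))\<^sup>2 - (norm (norm z *\<^sub>R Dd z))\<^sup>2"
      by (simp add: power_mult_distrib power_le_one left_diff_distrib)
  qed simp
  also have "\<dots> = (LINT z:disc|lborel. (norm (Dd z))\<^sup>2) - (LINT z:disc|lborel. (norm (norm z *\<^sub>R Dd z))\<^sup>2)"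
    by (rule set_integral_diff(2)[OF L2_on_norm_sq[OF l(2)] L2_on_norm_sq[OF norm_weight_L2_on[OF l(2)]]])
  also have "\<dots> \<le> 0" using 1 2 3 by linarith
  finally have "(LINT z:disc|lborel. (norm (?s z *\<^sub>R Dd z))\<^sup>2) = 0"
    by (intro antisym set_integral_nonneg' zero_le_power2)
  from set_integral_norm_sq_eq_0D[OF ls this]
  have "AE z in lborel. z \<in> disc \<longrightarrow> Dd z = 0"
  proof eventually_elim
    fix z :: "real \<times> real" assume z: "z \<in> disc \<longrightarrow> ?s z *\<^sub>R Dd z = 0"
    show "z \<in> disc \<longrightarrow> Dd z = 0"
    proof
      assume "z \<in> disc"
      then have "(norm z)\<^sup>2 < 1" by (simp add: power_less_one_iff)
      with z \<open>z \<in> disc\<close> show "Dd z = 0" by simp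
    qed
  qed
  \<comment> \<open>With the gradient zero almost everywhere, the same Poincare inequality is used
    once more to make \<open>d\<close> itself vanish.\<close>
  then have "AE z in lborel. indicator disc z *\<^sub>R (norm (norm z *\<^sub>R Dd z))\<^sup>2 = 0"
    by eventually_elim (simp add: indicator_def)
  then have "(LINT z:disc|lborel. (norm (norm z *\<^sub>R Dd z))\<^sup>2) = 0"
    unfolding set_lebesgue_integral_def by (rule integral_eq_zero_AE)
  with 3 have "(LINT z:disc|lborel. (norm (d z))\<^sup>2) = 0"
    by (intro antisym set_integral_nonneg' zero_le_power2) simp
  from set_integral_norm_sq_eq_0D[OF l(1) this] show ?thesis
    by eventually_elim (simp add: d_def)
qed

lemma weak_solution_u:
  assumes "L2_on {0..2*pi} g" "\<And>t. g t = u (cos t, sin t)"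
  shows "weak_solution q g u"
  unfolding weak_solution_def
  using H1_trace_C1[OF u_C1 assms] weak_form_u[unfolded weak_form_def] by blast

end

subsection \<open>The normal derivative\<close>

lemma set_integral_exp:
  "(LINT t:{0..2*pi}|lborel. exp (\<i> * of_int k * of_real t)) = (if k = 0 then 2 * pi else 0 :: complex)"
proof -
  have c: "continuous_on {0..2*pi} (\<lambda>t. exp (\<i> * of_int k * of_real t) :: complex)"
    by (intro continuous_intros)
  then have i: "set_integrable lborel {0..2*pi} (\<lambda>t. exp (\<i> * of_int k * of_real t) :: complex)"
    unfolding set_integrable_def by (intro borel_integrable_compact) auto
  show ?thesis
  proof (cases "k = 0")
    case True
    then show ?thesis
      unfolding set_borel_integral_eq_integral(2)[OF i] by (simp add: scaleR_conv_of_real)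
  next
    case False
    have "((\<lambda>t. exp (\<i> * of_int k * of_real t)) has_integral
        exp (\<i> * of_int k * of_real (2 * pi)) / (\<i> * of_int k) - exp (\<i> * of_int k * of_real 0) / (\<i> * of_int k))
        {0..2*pi}"
    proof (rule fundamental_theorem_of_calculus)
      fix t :: real
      have "((\<lambda>w. exp (\<i> * of_int k * w) / (\<i> * of_int k)) has_field_derivative exp (\<i> * of_int k * of_real t))
          (at (of_real t))"
        using False by (auto intro!: derivative_eq_intros)
      then show "((\<lambda>t. exp (\<i> * of_int k * of_real t) / (\<i> * of_int k)) has_vector_derivative
          exp (\<i> * of_int k * of_real t)) (at t within {0..2*pi})"
        by (rule has_vector_derivative_real_field)
    qed simp
    moreover have "exp (\<i> * of_int k * of_real (2 * pi)) = (1 :: complex)"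
      using exp_integer_2pi[of "of_int k"] by (simp add: mult_ac)
    ultimately show ?thesis
      unfolding set_borel_integral_eq_integral(2)[OF i] using False by (simp add: integral_unique)
  qed
qed

lemma fourier_coeffs_mode:
  "fourier_coeffs (\<lambda>t. c * exp (\<i> * of_int n * of_real t)) = (\<lambda>k. if k = n then c else 0)"
proof
  fix k
  have "(\<lambda>t. c * exp (\<i> * of_int n * of_real t) * exp (- \<i> * of_int k * of_real t)) =
      (\<lambda>t. c * exp (\<i> * of_int (n - k) * of_real t))"
    by (auto simp: exp_add[symmetric] algebra_simps)
  note eq = this
  show "fourier_coeffs (\<lambda>t. c * exp (\<i> * of_int n * of_real t)) k = (if k = n then c else 0)"
    unfolding fourier_coeffs_def eq set_integral_mult_right set_integral_exp by simp
qed

lemma sobolev_mode: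
  "(\<lambda>k. if k = n then c else 0) \<in> sobolev \<alpha>"
  "sobolev_norm \<alpha> (\<lambda>k. if k = n then c else 0) = sqrt ((1 + (of_int n)\<^sup>2) powr \<alpha>) * norm c"
proof -
  have "(\<lambda>k. (1 + (of_int k)\<^sup>2) powr \<alpha> * (norm (if k = n then c else 0))\<^sup>2) summable_on UNIV
      \<longleftrightarrow> (\<lambda>k. (1 + (of_int k)\<^sup>2) powr \<alpha> * (norm (if k = n then c else 0))\<^sup>2) summable_on {n}"
    by (rule summable_on_cong_neutral) auto
  then show "(\<lambda>k. if k = n then c else 0) \<in> sobolev \<alpha>"
    unfolding sobolev_def by simp
  have "(\<Sum>\<^sub>\<infinity>k. (1 + (of_int k)\<^sup>2) powr \<alpha> * (norm (if k = n then c else 0))\<^sup>2) =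
      (\<Sum>\<^sub>\<infinity>k\<in>{n}. (1 + (of_int k)\<^sup>2) powr \<alpha> * (norm (if k = n then c else 0))\<^sup>2)"
    by (rule infsum_cong_neutral) auto
  then show "sobolev_norm \<alpha> (\<lambda>k. if k = n then c else 0) = sqrt ((1 + (of_int n)\<^sup>2) powr \<alpha>) * norm c"
    unfolding sobolev_norm_def by (simp add: real_sqrt_mult)
qed

lemma sobolev_norm_ge:
  assumes "a \<in> sobolev \<alpha>"
  shows "sqrt ((1 + (of_int k)\<^sup>2) powr \<alpha>) * norm (a k) \<le> sobolev_norm \<alpha> a"
proof -
  have "(\<Sum>\<^sub>\<infinity>j\<in>{k}. (1 + (of_int j)\<^sup>2) powr \<alpha> * (norm (a j))\<^sup>2) \<le>
      (\<Sum>\<^sub>\<infinity>j. (1 + (of_int j)\<^sup>2) powr \<alpha> * (norm (a j))\<^sup>2)"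
    using assms by (intro infsum_mono_neutral) (auto simp: sobolev_def)
  then have "sqrt ((1 + (of_int k)\<^sup>2) powr \<alpha> * (norm (a k))\<^sup>2) \<le> sobolev_norm \<alpha> a"
    unfolding sobolev_norm_def by (intro real_sqrt_le_mono) simp
  then show ?thesis by (simp add: real_sqrt_mult)
qed

text \<open>One coefficient is bounded by the norm divided by its positive weight. This is how a
  limit of radial derivatives gets identified.\<close>

lemma sobolev_tendsto_coeff:
  assumes "sobolev_tendsto \<alpha> G a F"
  shows "((\<lambda>r. G r k) \<longlongrightarrow> a k) F"
proof -
  let ?w = "sqrt ((1 + (of_int k)\<^sup>2) powr \<alpha>)"
  have "1 + (real_of_int k)\<^sup>2 > 0" by (intro add_pos_nonneg) auto
  then have w: "?w > 0" by simp
  have "((\<lambda>r. sobolev_norm \<alpha> (\<lambda>n. G r n - a n)) \<longlongrightarrow> 0) F"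
    using assms unfolding sobolev_tendsto_def by blast
  then have lim: "((\<lambda>r. sobolev_norm \<alpha> (\<lambda>n. G r n - a n) / ?w) \<longlongrightarrow> 0) F"
    by (rule tendsto_divide_zero)
  have "\<forall>\<^sub>F r in F. norm (G r k - a k) \<le> sobolev_norm \<alpha> (\<lambda>n. G r n - a n) / ?w"
    using assms unfolding sobolev_tendsto_def
  proof (elim conjE eventually_mono)
    fix r assume "(\<lambda>n. G r n - a n) \<in> sobolev \<alpha>"
    from sobolev_norm_ge[OF this, of k] w
    show "norm (G r k - a k) \<le> sobolev_norm \<alpha> (\<lambda>n. G r n - a n) / ?w"
      by (simp add: pos_le_divide_eq mult.commute)
  qed
  from Lim_null_comparison[OF this lim]
  show ?thesis by (rule LIM_zero_cancel)
qed

lemma sobolev_tendsto_mode: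
  assumes "(c \<longlongrightarrow> d) F"
  shows "sobolev_tendsto \<alpha> (\<lambda>r k. if k = n then c r else 0) (\<lambda>k. if k = n then d else 0) F"
proof -
  have eq: "(\<lambda>k. (if k = n then c r else 0) - (if k = n then d else 0)) = (\<lambda>k. if k = n then c r - d else 0)" for r
    by auto
  have "((\<lambda>r. sqrt ((1 + (of_int n)\<^sup>2) powr \<alpha>) * norm (c r - d)) \<longlongrightarrow> sqrt ((1 + (of_int n)\<^sup>2) powr \<alpha>) * 0) F"
    by (intro tendsto_mult tendsto_const tendsto_norm_zero LIM_zero assms)
  then show ?thesis unfolding sobolev_tendsto_def eq sobolev_mode(2) by (simp add: sobolev_mode(1))
qed

text \<open>The set where the two functions differ is open and null, hence empty.\<close>

lemma continuous_on_AE_eq: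
  fixes f g :: "'a::euclidean_space \<Rightarrow> 'b::real_normed_vector"
  assumes "open S" "continuous_on S f" "continuous_on S g" and ae: "AE x in lborel. x \<in> S \<longrightarrow> f x = g x"
    and "x \<in> S"
  shows "f x = g x"
proof (rule ccontr)
  assume ne: "f x \<noteq> g x"
  define A where "A = S \<inter> (\<lambda>x. f x - g x) -` (- {0})"
  have "open A"
    unfolding A_def using assms(1-3) by (intro continuous_open_preimage continuous_on_diff) auto
  have "AE x in lborel. x \<notin> A"
    using ae by eventually_elim (auto simp: A_def)
  then have "A \<in> null_sets lborel"
    using \<open>open A\<close> by (subst AE_iff_null_sets) auto
  then have "negligible A"
    unfolding negligible_iff_null_sets by (rule null_sets_completionI)
  moreover have "x \<in> A" using ne \<open>x \<in> S\<close> by (simp add: A_def)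
  ultimately show False using open_not_negligible[OF \<open>open A\<close>] by blast
qed

section \<open>The mode in polar form and its boundary derivative\<close>

context angular_mode
begin

text \<open>The derivative of r^m \<open>profile\<close>(r^2), the radial factor of
  \<open>u\<close>.\<close>

definition mode_r :: "real \<Rightarrow> real" where
  "mode_r r = real m * r ^ (m - 1) * profile (r\<^sup>2) + r ^ m * (2 * r * profile' (r\<^sup>2))"

lemma u_polar: "u (r * cos t, r * sin t) = of_real (r ^ m * profile (r\<^sup>2)) * exp (\<i> * of_real (\<sigma> * real m) * of_real t)"
proof -
  have "\<sigma> = 1 \<or> \<sigma> = -1" using \<sigma> by (simp add: power2_eq_1_iff)
  then have "zz (r * cos t, r * sin t) = of_real r * exp (\<i> * of_real (\<sigma> * t))"
    by (auto simp: zz_def exp_Euler cos_of_real sin_of_real algebra_simps)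
  then have "zz (r * cos t, r * sin t) ^ m = of_real (r ^ m) * exp (of_nat m * (\<i> * of_real (\<sigma> * t)))"
    by (simp only: power_mult_distrib of_real_power exp_of_nat_mult)
  moreover have "rsq (r * cos t, r * sin t) = r\<^sup>2"
    using sin_cos_squared_add[of t] by (simp add: rsq_def power_mult_distrib flip: distrib_left)
  ultimately show ?thesis by (simp add: u_def mult_ac)
qed

lemma u_radial_deriv:
  "((\<lambda>s. u (s * cos t, s * sin t)) has_vector_derivative
    of_real (mode_r r) * exp (\<i> * of_real (\<sigma> * real m) * of_real t)) (at r)"
proof -
  have "((\<lambda>s. profile (s\<^sup>2)) has_real_derivative profile' (r\<^sup>2) * (2 * r)) (at r)"
    by (rule DERIV_chain2[OF profile_deriv]) (auto intro!: derivative_eq_intros)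
  then have "((\<lambda>s. s ^ m * profile (s\<^sup>2)) has_real_derivative mode_r r) (at r)"
    unfolding mode_r_def by (auto intro!: derivative_eq_intros)
  from has_vector_derivative_mult_left[OF has_vector_derivative_of_real[OF this]]
  show ?thesis unfolding u_polar .
qed

lemma mode_r_continuous: "isCont mode_r 1"
proof -
  have "isCont (\<lambda>r. profile (r\<^sup>2)) 1" "isCont (\<lambda>r. profile' (r\<^sup>2)) 1"
    by (intro isCont_o2[OF _ DERIV_isCont[OF profile_deriv]] isCont_o2[OF _ profile'_continuous] continuous_intros)+
  then show ?thesis unfolding mode_r_def[abs_def] by (intro continuous_intros)
qed

lemma mode_r_1: "mode_r 1 = real m + 2 * slope"
  by (simp add: mode_r_def profile_1)

context
  fixes n :: int
  assumes n: "of_int n = \<sigma> * real m"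
begin

lemma of_int_frequency: "of_real (\<sigma> * real m) = (of_int n :: complex)"
  unfolding n[symmetric] by simp

lemma fourier_radial_deriv:
  "fourier_coeffs (\<lambda>t. vector_derivative (\<lambda>s. u (s * cos t, s * sin t)) (at r)) =
    (\<lambda>k. if k = n then of_real (mode_r r) else 0)"
  using vector_derivative_at[OF u_radial_deriv] unfolding of_int_frequency fourier_coeffs_mode[symmetric] by simp

lemma mode_r_tendsto: "((\<lambda>r. complex_of_real (mode_r r)) \<longlongrightarrow> of_real (real m + 2 * slope)) (at_left 1)"
  using mode_r_continuous unfolding mode_r_1[symmetric] isCont_def
  by (intro tendsto_of_real) (rule tendsto_within_subset, auto)

lemma normal_derivative_u:
  "normal_derivative u (\<lambda>k. if k = n then of_real (real m + 2 * slope) else 0)"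
  unfolding normal_derivative_def
proof (intro conjI sobolev_mode bexI exI)
  show "AE x in lborel. 1 / 2 < norm x \<and> norm x < 1 \<longrightarrow> u x = u x" by simp
  show "C1_on {x. 1 / 2 < norm x \<and> norm x < 1} u (\<lambda>z. (ux z, uy z))" by (rule u_C1)
  show "sobolev_tendsto (-1/2)
    (\<lambda>r. fourier_coeffs (\<lambda>t. vector_derivative (\<lambda>s. u (s * cos t, s * sin t)) (at r)))
    (\<lambda>k. if k = n then of_real (real m + 2 * slope) else 0) (at_left 1)"
    unfolding fourier_radial_deriv by (rule sobolev_tendsto_mode[OF mode_r_tendsto])
qed simp

text \<open>For \<rho> < r < 1 the radial derivatives of the representative and of \<open>u\<close>
  have the same Fourier coefficients, since the two functions agree near radius r on every ray.
  Uniqueness of limits, coefficient by coefficient, then determines \<open>h\<close>.\<close>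

lemma normal_derivative_unique:
  assumes nd: "normal_derivative v h" and v: "AE x in lborel. x \<in> disc \<longrightarrow> v x = u x"
  shows "h = (\<lambda>k. if k = n then of_real (real m + 2 * slope) else 0)"
proof
  fix k
  obtain \<rho> w Dw where \<rho>: "\<rho> \<in> {0<..<1}"
    and w: "AE x in lborel. \<rho> < norm x \<and> norm x < 1 \<longrightarrow> w x = v x"
    and C1: "C1_on {x. \<rho> < norm x \<and> norm x < 1} w Dw"
    and lim: "sobolev_tendsto (-1/2)
          (\<lambda>r. fourier_coeffs (\<lambda>t. vector_derivative (\<lambda>s. w (s * cos t, s * sin t)) (at r)))
          h (at_left 1)"
    using nd unfolding normal_derivative_def by blast
  have "AE x in lborel. x \<in> {x. \<rho> < norm x \<and> norm x < 1} \<longrightarrow> w x = u x"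
    using w v by eventually_elim auto
  moreover have "open {x :: real \<times> real. \<rho> < norm x \<and> norm x < 1}"
    by (intro open_Collect_conj open_Collect_less continuous_intros)
  ultimately have eq: "w x = u x" if "\<rho> < norm x" "norm x < 1" for x
    using that continuous_on_AE_eq[OF _ C1_on_continuous[OF C1] ux_continuous(1)] by blast
  have fc: "fourier_coeffs (\<lambda>t. vector_derivative (\<lambda>s. w (s * cos t, s * sin t)) (at r)) k =
      (if k = n then of_real (mode_r r) else 0)" if r: "\<rho> < r" "r < 1" for r
  proof -
    have "vector_derivative (\<lambda>s. w (s * cos t, s * sin t)) (at r) =
        vector_derivative (\<lambda>s. u (s * cos t, s * sin t)) (at r)" for t
    proof (rule vector_derivative_cong_eq)
      have "\<forall>\<^sub>F s in nhds r. s \<in> {\<rho><..<1}"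
        using r by (intro eventually_nhds_in_open) auto
      then show "\<forall>\<^sub>F s in nhds r. s \<in> UNIV \<longrightarrow> w (s * cos t, s * sin t) = u (s * cos t, s * sin t)"
      proof eventually_elim
        fix s assume "s \<in> {\<rho><..<1}"
        moreover have "norm (s * cos t, s * sin t) = \<bar>s\<bar>"
          by (simp add: norm_Pair power_mult_distrib flip: distrib_left)
        ultimately show "s \<in> UNIV \<longrightarrow> w (s * cos t, s * sin t) = u (s * cos t, s * sin t)"
          using \<rho> by (intro impI eq) auto
      qed
    qed simp_all
    then show ?thesis by (simp only: fourier_radial_deriv)
  qed
  have "\<forall>\<^sub>F r in at_left 1. r \<in> {\<rho><..<1}"
    using \<rho> by (intro eventually_at_leftI) auto
  then have "\<forall>\<^sub>F r in at_left 1. fourier_coeffs (\<lambda>t. vector_derivative (\<lambda>s. w (s * cos t, s * sin t)) (at r)) k =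
      (if k = n then of_real (mode_r r) else 0)"
  proof (rule eventually_mono)
    fix r assume "r \<in> {\<rho><..<1}"
    then show "fourier_coeffs (\<lambda>t. vector_derivative (\<lambda>s. w (s * cos t, s * sin t)) (at r)) k =
      (if k = n then of_real (mode_r r) else 0)" by (intro fc) auto
  qed
  from tendsto_cong[OF this] sobolev_tendsto_coeff[OF lim, of k]
  have "((\<lambda>r. if k = n then complex_of_real (mode_r r) else 0) \<longlongrightarrow> h k) (at_left 1)" by simp
  moreover have "((\<lambda>r. if k = n then complex_of_real (mode_r r) else 0) \<longlongrightarrow>
      (if k = n then of_real (real m + 2 * slope) else 0)) (at_left 1)"
    using mode_r_tendsto by (cases "k = n") (simp_all only: if_True if_False tendsto_const simp_thms)
  ultimately show "h k = (if k = n then of_real (real m + 2 * slope) else 0)"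
    by (intro tendsto_unique[OF trivial_limit_at_left_real])
qed

text \<open>The definite description requires existence and uniqueness of \<open>h\<close>, not of
  the solution as a function: solutions agree only almost everywhere, and the boundary derivative
  does not see the difference.\<close>

lemma dtn_map_mode:
  "dtn_map q (\<lambda>t. exp (\<i> * of_int n * of_real t)) = (\<lambda>k. if k = n then of_real (real m + 2 * slope) else 0)"
proof -
  let ?g = "\<lambda>t. exp (\<i> * of_int n * of_real t) :: complex"
  have g: "?g t = u (cos t, sin t)" for t
    using u_polar[of 1 t] by (simp add: profile_1 of_int_frequency[simplified])
  have L2: "L2_on {0..2*pi} ?g"
    by (rule continuous_on_imp_L2_on[of "{0..2*pi}"]) (auto intro!: continuous_intros)
  have "?g (t + 2 * pi) = ?g t" for t
  proof -
    have "?g (t + 2 * pi) = ?g t * exp (\<i> * of_int n * of_real (2 * pi))"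
      by (simp add: exp_add[symmetric] algebra_simps)
    also have "exp (\<i> * of_int n * of_real (2 * pi)) = (1 :: complex)"
      using exp_integer_2pi[of "of_int n"] by (simp add: mult_ac)
    finally show ?thesis by simp
  qed
  moreover have "fourier_coeffs ?g \<in> sobolev (1/2)"
    using fourier_coeffs_mode[of 1 n] sobolev_mode(1)[of n 1 "1/2"] by simp
  ultimately have H: "?g \<in> H_half" using L2 by (simp add: H_half_def)
  show ?thesis
    unfolding dtn_map_def
  proof (rule the_equality)
    show "?g \<in> H_half \<and> (\<exists>v. weak_solution q ?g v \<and>
        normal_derivative v (\<lambda>k. if k = n then of_real (real m + 2 * slope) else 0))"
      using H weak_solution_u[OF L2 g] normal_derivative_u by blast
    fix h assume "?g \<in> H_half \<and> (\<exists>v. weak_solution q ?g v \<and> normal_derivative v h)"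
    then show "h = (\<lambda>k. if k = n then of_real (real m + 2 * slope) else 0)"
      using normal_derivative_unique weak_solution_unique[OF _ g] by blast
  qed
qed

end

end

theorem theorem1:
  fixes b \<gamma> :: real and q :: "real \<times> real \<Rightarrow> real" and n :: int
  assumes "0 < b" and "b < 1" and "0 \<le> \<gamma>" and "\<gamma> \<le> 1"
    and "q = (\<lambda>x. \<gamma> * indicator {0<..<b} (norm x))"
  shows "dtn_map q (\<lambda>\<theta>. exp (\<i> * of_int n * of_real \<theta>)) =
         fourier_coeffs (\<lambda>\<theta>. of_real (dtn_coeff b \<gamma> n) * exp (\<i> * of_int n * of_real \<theta>))"
proof -
  \<comment> \<open>Frequency \<open>n\<close> is split into m = |n| and its sign; at n = 0 the sign
    1 is chosen to satisfy \<sigma>^2 = 1.\<close>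
  interpret angular_mode b \<gamma> "nat \<bar>n\<bar>" "if n < 0 then -1 else 1"
    by unfold_locales (use assms in auto)
  have "q = angular_mode.q b \<gamma>"
    unfolding assms(5) by (rule ext) (simp only: q_def)
  moreover have "of_int n = (if n < 0 then -1 else 1) * real (nat \<bar>n\<bar>)"
    by simp
  ultimately show ?thesis
    unfolding fourier_coeffs_mode dtn_coeff_eq[OF refl] using dtn_map_mode by simp
qed

end
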